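(* Assume there exist $w^{(0)}\in\mathcal K$ and $\epsilon_0$ such that $F(w^{(0)})-F_*\le\epsilon_0$, and a constant $G$ such that $\|\partial f(w;\xi)\|_2\le G$. Let $\epsilon\le\epsilon_0/4$, $\omega=1$, and $K=\lceil\log_2(\epsilon_0/\epsilon)\rceil$ in the algorithm RASSG. Suppose $D_1^{(1)}$ is sufficiently large so that there exists $\hat\epsilon_1\in[\epsilon,\epsilon_0/2]$ with which $F$ satisfies the local growth condition $$\|w-w_*\|_2\le c\,(F(w)-F_* )^\theta\quad\text{for all } w\in\mathcal S_{\hat\epsilon_1}$$ with $\theta\in(0,1)$ and the constant $c$ (where $w_*$ is the point of $\mathcal K_*$ closest to $w$), and $D_1^{(1)}=\frac{c\,\epsilon_0}{\hat\epsilon_1^{\,1-\theta}}$. Let $\hat\delta=\frac{\delta}{K(K+1)}$ and $t_1=\max\{9,1728\log(1/\hat\delta)\}\,\big(GD_1^{(1)}/\epsilon_0\big)^2$. Then with at most $S=\lceil\log_2(\hat\epsilon_1/\epsilon)\rceil+1$ calls of ASSG-c, RASSG finds a solution $w^{(S)}$ such that $$F(w^{(S)})-F_*\le2\epsilon$$ with probability $1-\delta$. The total number of iterations of RASSG for obtaining a $2\epsilon$-optimal solution is upper bounded by $$T_S=O\left(\Big\lceil\log_2\frac{\epsilon_0}{\epsilon}\Big\rceil\,\frac{\log(1/\delta)\,c^2}{\epsilon^{2(1-\theta)}}\right).$$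
   Context: Setting: $\mathcal K\subseteq\mathbb R^d$ is a closed convex set, $\xi$ is a random variable, $f(w;\xi)$ is a convex function of $w$, $F(w)=\mathbb E_\xi[f(w;\xi)]$, $F_*=\min_{w\in\mathcal K}F(w)$, and $\mathcal K_*=\arg\min_{w\in\mathcal K}F(w)$ is the (nonempty) optimal set. $\partial f(w;\xi)$ denotes a subgradient of $f(\cdot;\xi)$ at $w$. $\mathcal S_\epsilon=\{w\in\mathcal K:F(w)\le F_*+\epsilon\}$. $\mathcal B(w,r)$ is the Euclidean ball of radius $r$ centred at $w$ and $\Pi_C$ is Euclidean projection onto $C$. A point $w$ is $2\epsilon$-optimal if $F(w)-F_*\le2\epsilon$. Algorithm ASSG-c$(w_0,K,t,D_1,\epsilon_0)$: set $\eta_1=\epsilon_0/(3G^2)$. For $k=1,\dots,K$: let $w_1^k=w_{k-1}$; for $\tau=1,\dots,t-1$ let $w^k_{\tau+1}=\Pi_{\mathcal K\cap\mathcal B(w_{k-1},D_k)}[w^k_\tau-\eta_k\,\partial f(w^k_\tau;\xi^k_\tau)]$ with $\xi^k_\tau$ independent samples of $\xi$; let $w_k=\frac1t\sum_{\tau=1}^tw^k_\tau$, $\eta_{k+1}=\eta_k/2$, $D_{k+1}=D_k/2$. Output $w_K$. Algorithm RASSG (inputs $w^{(0)},K,D_1^{(1)},t_1,\epsilon_0,\omega\in(0,1]$; uses $\theta$): set $\epsilon_0^{(1)}=\epsilon_0$. For $s=1,\dots,S$: let $w^{(s)}=$ ASSG-c$(w^{(s-1)},K,t_s,D_1^{(s)},\epsilon_0^{(s)})$,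 then set $t_{s+1}=t_s2^{2(1-\theta)}$, $D_1^{(s+1)}=D_1^{(s)}2^{1-\theta}$, $\epsilon_0^{(s+1)}=\omega\,\epsilon_0^{(s)}$. Output $w^{(S)}$.
   Formalization: The bound on T_S is proved with log(1/δ̂), δ̂ = δ/(K(K+1)), in place of log(1/δ); the bound with log(1/δ) is proved, with constant C(1+p), only when K(K+1) ≤ (1/δ)^p, since it fails uniformly as ε → 0 with δ fixed. *)

theory Defs
  imports "HOL-Probability.Probability"
begin

definition subgradient :: "('a::real_inner \<Rightarrow> real) \<Rightarrow> 'a \<Rightarrow> 'a \<Rightarrow> bool" where
  "subgradient h w v \<longleftrightarrow> (\<forall>u. h u \<ge> h w + v \<bullet> (u - w))"

definition optimal_value :: "'a set \<Rightarrow> ('a \<Rightarrow> real) \<Rightarrow> real" where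
  "optimal_value \<K> F = (INF w\<in>\<K>. F w)"

definition optimal_set :: "'a set \<Rightarrow> ('a \<Rightarrow> real) \<Rightarrow> 'a set" where
  "optimal_set \<K> F = {w. is_arg_min F (\<lambda>w. w \<in> \<K>) w}"

definition sublevel_set :: "'a set \<Rightarrow> ('a \<Rightarrow> real) \<Rightarrow> real \<Rightarrow> 'a set" where
  "sublevel_set \<K> F \<epsilon> = {w \<in> \<K>. F w \<le> optimal_value \<K> F + \<epsilon>}"

definition local_growth ::
  "'a::euclidean_space set \<Rightarrow> ('a \<Rightarrow> real) \<Rightarrow> real \<Rightarrow> real \<Rightarrow> real \<Rightarrow> bool" where
  "local_growth \<K> F \<epsilon> c \<theta> \<longleftrightarrow>
     (\<forall>w \<in> sublevel_set \<K> F \<epsilon>.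
        norm (w - closest_point (optimal_set \<K> F) w) \<le> c * (F w - optimal_value \<K> F) powr \<theta>)"

text \<open>The random variable \<open>\<xi>\<close> enters through its law \<open>D\<close>.\<close>

definition objective :: "'x measure \<Rightarrow> ('a \<Rightarrow> 'x \<Rightarrow> real) \<Rightarrow> 'a \<Rightarrow> real" where
  "objective D f w = (\<integral>x. f w x \<partial>D)"

text \<open>\<open>g w x\<close> is the subgradient of \<open>f(\<cdot>; x)\<close> at \<open>w\<close> returned to the algorithm. Its joint
  measurability is what makes the iterates random variables; its values outside \<open>\<K>\<close> are
  never used.\<close>

locale stochastic_convex_problem = prob_space D
  for D :: "'x measure" +
  fixes \<K> :: "'a::euclidean_space set"
    and f :: "'a \<Rightarrow> 'x \<Rightarrow> real"
    and g :: "'a \<Rightarrow> 'x \<Rightarrow> 'a"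
  assumes closed_feasible: "closed \<K>"
    and convex_feasible: "convex \<K>"
    and convex_f: "\<And>x. x \<in> space D \<Longrightarrow> convex_on UNIV (\<lambda>w. f w x)"
    and integrable_f: "\<And>w. w \<in> \<K> \<Longrightarrow> integrable D (f w)"
    and optimal_set_nonempty: "optimal_set \<K> (objective D f) \<noteq> {}"
    and subgradient_g: "\<And>w x. w \<in> \<K> \<Longrightarrow> x \<in> space D \<Longrightarrow> subgradient (\<lambda>u. f u x) w (g w x)"
    and measurable_g: "(\<lambda>(w, x). g w x) \<in> borel_measurable (borel \<Otimes>\<^sub>M D)"

text \<open>\<open>X s k \<tau>\<close> is the sample drawn in call \<open>s\<close>, stage \<open>k\<close>, step \<open>\<tau>\<close>.\<close>

definition iid_samples ::
  "'o measure \<Rightarrow> 'x measure \<Rightarrow> (nat \<Rightarrow> nat \<Rightarrow> nat \<Rightarrow> 'o \<Rightarrow> 'x) \<Rightarrow> bool" where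
  "iid_samples P D X \<longleftrightarrow>
     prob_space P \<and>
     prob_space.indep_vars P (\<lambda>_. D) (\<lambda>(s, k, \<tau>). X s k \<tau>) UNIV \<and>
     (\<forall>s k \<tau>. distr P D (X s k \<tau>) = D)"

text \<open>The iterate \<open>w\<^sub>\<tau>\<close> of one stage is \<open>psg_iterate \<dots> (\<tau> - 1)\<close>, and the step from \<open>w\<^sub>\<tau>\<close>
  uses the sample \<open>x \<tau>\<close>.\<close>

primrec psg_iterate ::
  "'a::euclidean_space set \<Rightarrow> ('a \<Rightarrow> 'x \<Rightarrow> 'a) \<Rightarrow> (nat \<Rightarrow> 'x) \<Rightarrow> real \<Rightarrow> 'a \<Rightarrow> nat \<Rightarrow> 'a" where
  "psg_iterate C g x \<eta> w 0 = w"
| "psg_iterate C g x \<eta> w (Suc i) =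
     closest_point C (psg_iterate C g x \<eta> w i - \<eta> *\<^sub>R g (psg_iterate C g x \<eta> w i) (x (Suc i)))"

definition psg_average ::
  "'a::euclidean_space set \<Rightarrow> ('a \<Rightarrow> 'x \<Rightarrow> 'a) \<Rightarrow> (nat \<Rightarrow> 'x) \<Rightarrow> real \<Rightarrow> 'a \<Rightarrow> nat \<Rightarrow> 'a" where
  "psg_average C g x \<eta> w t = (1 / real t) *\<^sub>R (\<Sum>\<tau>=1..t. psg_iterate C g x \<eta> w (\<tau> - 1))"

text \<open>The last argument is the number of stages completed, so the step size and radius of
  stage \<open>k + 1\<close> are \<open>\<eta>\<^sub>1 / 2 ^ k\<close> and \<open>D\<^sub>1 / 2 ^ k\<close>.\<close>

primrec assg_c ::
  "'a::euclidean_space set \<Rightarrow> ('a \<Rightarrow> 'x \<Rightarrow> 'a) \<Rightarrow> real \<Rightarrow> (nat \<Rightarrow> nat \<Rightarrow> 'x)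
    \<Rightarrow> 'a \<Rightarrow> nat \<Rightarrow> real \<Rightarrow> real \<Rightarrow> nat \<Rightarrow> 'a" where
  "assg_c \<K> g G x w0 t D1 \<epsilon>0 0 = w0"
| "assg_c \<K> g G x w0 t D1 \<epsilon>0 (Suc k) =
     (let w = assg_c \<K> g G x w0 t D1 \<epsilon>0 k
      in psg_average (\<K> \<inter> cball w (D1 / 2 ^ k)) g (x (Suc k)) ((\<epsilon>0 / (3 * G\<^sup>2)) / 2 ^ k) w t)"

text \<open>The prescribed \<open>t\<^sub>s\<close> are real numbers and are propagated exactly; call \<open>s\<close> rounds its
  own \<open>t\<^sub>s\<close> up.\<close>

definition rassg_t :: "real \<Rightarrow> real \<Rightarrow> nat \<Rightarrow> real" where
  "rassg_t \<theta> t1 s = t1 * (2 powr (2 * (1 - \<theta>))) ^ (s - 1)"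

primrec rassg ::
  "'a::euclidean_space set \<Rightarrow> ('a \<Rightarrow> 'x \<Rightarrow> 'a) \<Rightarrow> real \<Rightarrow> real \<Rightarrow> real
    \<Rightarrow> (nat \<Rightarrow> nat \<Rightarrow> nat \<Rightarrow> 'x) \<Rightarrow> 'a \<Rightarrow> nat \<Rightarrow> real \<Rightarrow> real \<Rightarrow> real \<Rightarrow> nat \<Rightarrow> 'a" where
  "rassg \<K> g G \<theta> \<omega> x w0 K D1 t1 \<epsilon>0 0 = w0"
| "rassg \<K> g G \<theta> \<omega> x w0 K D1 t1 \<epsilon>0 (Suc s) =
     assg_c \<K> g G (x (Suc s)) (rassg \<K> g G \<theta> \<omega> x w0 K D1 t1 \<epsilon>0 s)
       (nat \<lceil>rassg_t \<theta> t1 (Suc s)\<rceil>) (D1 * (2 powr (1 - \<theta>)) ^ s) (\<epsilon>0 * \<omega> ^ s) K"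

text \<open>With \<open>t\<close> averaged iterates, a stage performs \<open>t - 1\<close> projected subgradient steps.\<close>

definition rassg_iterations :: "real \<Rightarrow> nat \<Rightarrow> real \<Rightarrow> nat \<Rightarrow> nat" where
  "rassg_iterations \<theta> K t1 S = (\<Sum>s=1..S. K * (nat \<lceil>rassg_t \<theta> t1 s\<rceil> - 1))"

end

theory Submission
  imports Defs
begin

text \<open>
  The method converges because each stage halves the optimality gap, up to a floor \<open>\<epsilon>\<close>, inside a
  trust region that still contains a good comparison point.

  \<^item> Geometry. Suppose \<open>w\<close> has gap at most \<open>e + \<epsilon>\<close>, and let \<open>v\<close> be the optimal point closest
    to \<open>w\<close>. A suitable point \<open>u\<close> of the segment from \<open>v\<close> to \<open>w\<close> has gap at most \<open>\<epsilon>\<close> by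
    convexity. Its closest optimal point is again \<open>v\<close>, so local growth bounds the distance from \<open>u\<close>
    to \<open>v\<close>, and the ratio in which \<open>u\<close> divides the segment turns this into
    \<open>norm (w - u) \<le> c * e / \<epsilon> powr (1 - \<theta>)\<close> (lemma \<open>norm_diff_reference_point_le\<close>). The radius of a
    stage with gap \<open>e + \<epsilon>\<close> is at least this bound, so \<open>u\<close> is feasible for the stage.

  \<^item> One stage. The regret bound for projected subgradient steps compares the averaged iterate with
    \<open>u\<close> up to a sum of centred noise terms (\<open>objective_psg_average_le\<close>). With the prescribed step
    size and number of steps, the start distance and the subgradient norms contribute \<open>e / 6\<close> each, and
    the noise contributes at most \<open>e / 6\<close> outside an event of probability \<open>\<delta>\<close>
    (\<open>stage_high_probability\<close>), so that the gap drops from \<open>e + \<epsilon>\<close> to \<open>e / 2 + \<epsilon>\<close>.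

  \<^item> Noise. All samples are read off from one infinite product space. Redrawing one coordinate from \<open>D\<close>
    leaves the product measure unchanged (\<open>nn_integral_PiM_resample\<close>), so the newest noise term
    can be integrated with everything older held fixed. Hoeffding's lemma bounds that inner
    integral, induction bounds the exponential moment of the sum, and Markov's inequality bounds its
    tail (\<open>adapted_sum_tail_le\<close>). The comparison point depends on the random start of the stage, but
    not on the samples of the stage, and this is all that the argument needs.

  \<^item> Restarts. Call \<open>s\<close> applies the stage bound with the floor \<open>\<epsilon>1 / 2 ^ (s - 1)\<close>: multiplying the radius
    by \<open>2 powr (1 - \<theta>)\<close> compensates exactly for halving the floor, and multiplying the number of steps
    by \<open>2 powr (2 * (1 - \<theta>))\<close> compensates for the larger radius. Since \<open>S \<le> K\<close>, there are at most
    \<open>K * K\<close> stages, and a union bound over them costs at most \<open>\<delta>\<close>. The iteration count is a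
    geometric sum, dominated by its last term.

  Measurability of the iterates is part of the claim, because the measure of a nonmeasurable set is \<open>0\<close>.
  The projections of a stage are onto a set that moves with the random start, and the first section
  shows that they depend continuously on the start and on the projected point together.
\<close>

section \<open>Projection onto a moving trust region\<close>

lemma trust_region_nonempty_convex_closed:
  fixes S :: "'a::euclidean_space set"
  assumes "closed S" "convex S" "0 < r" "w \<in> S"
  shows "closed (S \<inter> cball w r)" "convex (S \<inter> cball w r)" "w \<in> S \<inter> cball w r" "S \<inter> cball w r \<noteq> {}"
  using assms by (auto intro: convex_Int)

text \<open>Shrinking \<open>p\<close> towards \<open>w\<close> by the factor \<open>1 - dist w v / r\<close> makes exactly the room needed to
  move the centre from \<open>w\<close> to \<open>v\<close>. Convexity keeps the shrunken point in \<open>S\<close>.\<close>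

lemma trust_region_near_point:
  fixes S :: "'a::euclidean_space set"
  assumes "convex S" "0 < r" "w \<in> S" "v \<in> S" "dist w v \<le> r" "p \<in> S \<inter> cball w r"
  shows "\<exists>q \<in> S \<inter> cball v r. dist p q \<le> dist w v"
proof -
  define s where "s = dist w v / r"
  have s: "0 \<le> s" "s \<le> 1" "s * r = dist w v" using assms by (auto simp: s_def)
  define q where "q = (1 - s) *\<^sub>R p + s *\<^sub>R w"
  have pw: "norm (p - w) \<le> r" using assms by (auto simp: dist_norm norm_minus_commute)
  have "q \<in> S" unfolding q_def using assms s by (intro convexD) auto
  moreover have "norm (q - v) \<le> r"
  proof -
    have "q - v = (1 - s) *\<^sub>R (p - w) + (w - v)" by (simp add: q_def algebra_simps)
    then have "norm (q - v) \<le> norm ((1 - s) *\<^sub>R (p - w)) + norm (w - v)"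
      by (metis norm_triangle_ineq)
    also have "\<dots> \<le> (1 - s) * r + s * r"
      using s pw by (intro add_mono) (auto simp: dist_norm intro: mult_left_mono)
    finally show ?thesis by (simp add: algebra_simps)
  qed
  moreover have "dist p q \<le> dist w v"
  proof -
    have "p - q = s *\<^sub>R (p - w)" by (simp add: q_def algebra_simps)
    then have "dist p q = s * norm (p - w)" using s by (simp add: dist_norm)
    also have "\<dots> \<le> s * r" using s pw by (intro mult_left_mono) auto
    finally show ?thesis using s by simp
  qed
  ultimately show ?thesis by (auto simp: dist_norm norm_minus_commute)
qed

text \<open>Each projection satisfies its variational inequality against the other projection, up to an
  error proportional to \<open>dist w v\<close>, since the other projection is that close to the competing set. Adding
  the two inequalities gives a Hoelder bound of exponent one half in the centre.\<close>

lemma dist_closest_point_trust_regions: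
  fixes S :: "'a::euclidean_space set" and x :: 'a
  assumes S: "closed S" "convex S" and r: "0 < r" and wv: "w \<in> S" "v \<in> S" "dist w v \<le> r"
  defines "p \<equiv> closest_point (S \<inter> cball w r) x" and "q \<equiv> closest_point (S \<inter> cball v r) x"
  shows "(dist p q)\<^sup>2 \<le> dist w v * (dist x p + dist x q)"
proof -
  note W = trust_region_nonempty_convex_closed[OF S r wv(1)]
  note V = trust_region_nonempty_convex_closed[OF S r wv(2)]
  have p: "p \<in> S \<inter> cball w r" unfolding p_def by (rule closest_point_in_set[OF W(1,4)])
  have q: "q \<in> S \<inter> cball v r" unfolding q_def by (rule closest_point_in_set[OF V(1,4)])
  obtain p' where p': "p' \<in> S \<inter> cball v r" "dist p p' \<le> dist w v"
    using trust_region_near_point[OF S(2) r wv p] by blast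
  obtain q' where q': "q' \<in> S \<inter> cball w r" "dist q q' \<le> dist w v"
    using trust_region_near_point[OF S(2) r wv(2,1) _ q] wv(3) unfolding dist_commute[of v w] by blast
  have 1: "(x - p) \<bullet> (q' - p) \<le> 0" unfolding p_def by (rule closest_point_dot[OF W(2,1) q'(1)])
  have 2: "(x - q) \<bullet> (p' - q) \<le> 0" unfolding q_def by (rule closest_point_dot[OF V(2,1) p'(1)])
  have "(dist p q)\<^sup>2 = (x - q) \<bullet> ((p - p') + (p' - q)) + (x - p) \<bullet> ((q - q') + (q' - p))"
    unfolding dist_norm power2_norm_eq_inner by (simp add: inner_diff_left inner_diff_right inner_commute)
  also have "\<dots> = (x - q) \<bullet> (p - p') + (x - q) \<bullet> (p' - q) + ((x - p) \<bullet> (q - q') + (x - p) \<bullet> (q' - p))"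
    by (simp only: inner_add_right)
  also have "\<dots> \<le> (x - q) \<bullet> (p - p') + (x - p) \<bullet> (q - q')" using 1 2 by simp
  also have "\<dots> \<le> norm (x - q) * norm (p - p') + norm (x - p) * norm (q - q')"
    by (intro add_mono norm_cauchy_schwarz)
  also have "\<dots> \<le> norm (x - q) * dist w v + norm (x - p) * dist w v"
    using p' q' by (intro add_mono mult_left_mono) (auto simp: dist_norm)
  finally show ?thesis by (simp add: dist_norm algebra_simps)
qed

lemma continuous_on_closest_point_trust_region:
  fixes S :: "'a::euclidean_space set"
  assumes S: "closed S" "convex S" and r: "0 < r"
  shows "continuous_on (S \<times> UNIV) (\<lambda>(w, x). closest_point (S \<inter> cball w r) x)"
  unfolding continuous_on_def
proof (intro ballI)
  fix z assume "z \<in> S \<times> (UNIV :: 'a set)"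
  then obtain w x where z: "z = (w, x)" and w: "w \<in> S" by auto
  define P where "P = (\<lambda>v y. closest_point (S \<inter> cball v r) y)"
  let ?F = "at (w, x) within S \<times> UNIV"
  have fst_lim: "((\<lambda>u. fst u) \<longlongrightarrow> w) ?F" and snd_lim: "((\<lambda>u. snd u) \<longlongrightarrow> x) ?F"
    using tendsto_fst[OF tendsto_ident_at, of "(w, x)" "S \<times> UNIV"]
      tendsto_snd[OF tendsto_ident_at, of "(w, x)" "S \<times> UNIV"] by auto
  define b where "b = (\<lambda>u. dist (snd u) x
      + sqrt (dist (fst u) w * (2 * (dist x (fst u) + dist x w + 2 * r))))"
  have b0: "(b \<longlongrightarrow> 0) ?F"
  proof -
    have "(b \<longlongrightarrow> dist x x + sqrt (dist w w * (2 * (dist x w + dist x w + 2 * r)))) ?F"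
      unfolding b_def by (intro tendsto_intros fst_lim snd_lim)
    then show ?thesis by simp
  qed
  have bound: "dist (P (fst u) (snd u)) (P w x) \<le> b u" if u: "fst u \<in> S" "dist (fst u) w \<le> r" for u
  proof -
    obtain v y where vy: "u = (v, y)" by force
    have v: "v \<in> S" "dist v w \<le> r" using u vy by auto
    note V = trust_region_nonempty_convex_closed[OF S r v(1)]
    note W = trust_region_nonempty_convex_closed[OF S r w]
    have "dist (P v y) (P v x) \<le> dist y x"
      unfolding P_def by (rule closest_point_lipschitz[OF V(2,1,4)])
    moreover have "dist (P v x) (P w x) \<le> sqrt (dist v w * (2 * (dist x v + dist x w + 2 * r)))"
    proof (rule real_le_rsqrt)
      have "dist x (P v x) \<le> dist x v" "dist x (P w x) \<le> dist x w"
        unfolding P_def by (rule closest_point_le[OF V(1,3)], rule closest_point_le[OF W(1,3)])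
      then have "dist x (P v x) + dist x (P w x) \<le> dist x v + dist x w" by (rule add_mono)
      also have "\<dots> \<le> 2 * (dist x v + dist x w + 2 * r)" using r by (simp add: distrib_left)
      finally have "dist v w * (dist x (P v x) + dist x (P w x)) \<le> dist v w * (2 * (dist x v + dist x w + 2 * r))"
        by (rule mult_left_mono) simp
      then show "(dist (P v x) (P w x))\<^sup>2 \<le> dist v w * (2 * (dist x v + dist x w + 2 * r))"
        using dist_closest_point_trust_regions[OF S r v(1) w v(2), of x] unfolding P_def by linarith
    qed
    moreover have "dist (P v y) (P w x) \<le> dist (P v y) (P v x) + dist (P v x) (P w x)"
      by (rule dist_triangle)
    ultimately show ?thesis by (simp add: b_def vy)
  qed
  have "\<forall>\<^sub>F u in ?F. dist (P (fst u) (snd u)) (P w x) \<le> b u"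
  proof -
    have "\<forall>\<^sub>F u in ?F. dist (fst u) w < r" using fst_lim r by (auto simp: tendsto_iff)
    moreover have "\<forall>\<^sub>F u in ?F. u \<in> S \<times> UNIV" by (auto simp: eventually_at_filter)
    ultimately show ?thesis by eventually_elim (auto intro!: bound)
  qed
  then have "((\<lambda>u. P (fst u) (snd u)) \<longlongrightarrow> P w x) ?F"
    by (rule metric_tendsto_imp_tendsto[OF b0, OF eventually_mono]) (simp add: dist_real_def)
  then show "((\<lambda>(w, x). closest_point (S \<inter> cball w r) x) \<longlongrightarrow> (case z of (w, x) \<Rightarrow> closest_point (S \<inter> cball w r) x))
      (at z within S \<times> UNIV)"
    unfolding z P_def case_prod_unfold fst_conv snd_conv .
qed

text \<open>The objective is controlled only on the feasible set, so continuity on the whole space cannot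
  be used to obtain measurability.\<close>

lemma borel_measurable_continuous_on_compose:
  assumes "continuous_on A h" "Z \<in> measurable M borel" "\<And>z. z \<in> space M \<Longrightarrow> Z z \<in> A"
  shows "(\<lambda>z. h (Z z)) \<in> borel_measurable M"
proof (rule measurable_compose[where f = Z and g = h])
  show "Z \<in> measurable M (restrict_space borel A)"
    using assms by (auto intro: measurable_restrict_space2)
  show "h \<in> borel_measurable (restrict_space borel A)"
    by (rule borel_measurable_continuous_on_restrict[OF assms(1)])
qed

lemma borel_measurable_closest_point_trust_region:
  fixes S :: "'a::euclidean_space set"
  assumes "closed S" "convex S" "0 < r"
    and "W \<in> borel_measurable M" "Y \<in> borel_measurable M" "\<And>z. z \<in> space M \<Longrightarrow> W z \<in> S"
  shows "(\<lambda>z. closest_point (S \<inter> cball (W z) r) (Y z)) \<in> borel_measurable M"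
  using borel_measurable_continuous_on_compose
      [OF continuous_on_closest_point_trust_region[OF assms(1-3)], of "\<lambda>z. (W z, Y z)" M] assms(4-6)
  by simp

text \<open>If some point of \<open>S\<close> were closer to a point of the segment than \<open>v\<close> is, then by the triangle
  inequality it would also be closer to \<open>w\<close>.\<close>

lemma closest_point_on_segment_to_closest_point:
  fixes S :: "'a::euclidean_space set" and w :: 'a
  assumes S: "closed S" "convex S" "S \<noteq> {}" and l: "0 \<le> l" "l \<le> 1"
  defines "v \<equiv> closest_point S w"
  shows "closest_point S (v + l *\<^sub>R (w - v)) = v"
proof (rule closest_point_unique[symmetric, OF S(2,1)])
  show "v \<in> S" unfolding v_def using S by (intro closest_point_in_set)
  define u where "u = v + l *\<^sub>R (w - v)"
  show "\<forall>z\<in>S. dist (v + l *\<^sub>R (w - v)) v \<le> dist (v + l *\<^sub>R (w - v)) z"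
  proof
    fix z assume "z \<in> S"
    then have "dist w v \<le> dist w z" unfolding v_def using S by (intro closest_point_le)
    also have "\<dots> \<le> dist w u + dist u z" by (rule dist_triangle)
    also have "dist w u = (1 - l) * dist w v"
    proof -
      have "w - u = (1 - l) *\<^sub>R (w - v)" by (simp add: u_def algebra_simps)
      then show ?thesis using l by (simp add: dist_norm)
    qed
    finally have "l * dist w v \<le> dist u z" by (simp add: algebra_simps)
    moreover have "dist u v = l * dist w v" using l by (simp add: u_def dist_norm)
    ultimately show "dist (v + l *\<^sub>R (w - v)) v \<le> dist (v + l *\<^sub>R (w - v)) z" by (simp add: u_def)
  qed
qed

section \<open>Regret of projected subgradient steps\<close>

lemma psg_iterate_cong:
  assumes "\<And>\<tau>. \<tau> \<in> {1..i} \<Longrightarrow> x \<tau> = x' \<tau>"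
  shows "psg_iterate C g x \<eta> w i = psg_iterate C g x' \<eta> w i"
  using assms by (induction i) auto

lemma psg_iterate_in:
  assumes "closed C" "w \<in> C"
  shows "psg_iterate C g x \<eta> w i \<in> C"
  using assms by (cases i) (auto intro: closest_point_in_set)

lemma psg_average_eq:
  "psg_average C g x \<eta> w t = (\<Sum>i<t. (1 / real t) *\<^sub>R psg_iterate C g x \<eta> w i)"
proof -
  have "(\<Sum>\<tau>=1..t. psg_iterate C g x \<eta> w (\<tau> - 1)) = (\<Sum>i<t. psg_iterate C g x \<eta> w i)"
    by (rule sum.reindex_bij_witness[of _ Suc "\<lambda>i. i - 1"]) auto
  then show ?thesis by (simp add: psg_average_def scaleR_sum_right)
qed

lemma psg_average_in:
  assumes "closed C" "convex C" "w \<in> C" "0 < t"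
  shows "psg_average C g x \<eta> w t \<in> C"
  unfolding psg_average_eq using assms by (intro convex_sum psg_iterate_in) auto

text \<open>The squared distance to \<open>u\<close> telescopes, because projecting onto a convex set containing \<open>u\<close> does
  not increase the distance to \<open>u\<close>. The sum has \<open>t\<close> terms although only \<open>t - 1\<close> steps enter the average
  of \<open>t\<close> iterates: the last step is carried out only in the analysis, with a sample of its own.\<close>

lemma psg_regret:
  fixes C :: "'a::euclidean_space set"
  assumes C: "closed C" "convex C" "w \<in> C" "u \<in> C" and \<eta>: "0 < \<eta>"
    and bound: "\<And>i. i < t \<Longrightarrow> norm (g (psg_iterate C g x \<eta> w i) (x (Suc i))) \<le> G"
  shows "(\<Sum>i<t. g (psg_iterate C g x \<eta> w i) (x (Suc i)) \<bullet> (psg_iterate C g x \<eta> w i - u))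
    \<le> (norm (w - u))\<^sup>2 / (2 * \<eta>) + \<eta> * real t * G\<^sup>2 / 2"
proof -
  define W where "W = psg_iterate C g x \<eta> w"
  define v where "v = (\<lambda>i. g (W i) (x (Suc i)))"
  have step: "2 * \<eta> * (v i \<bullet> (W i - u)) \<le> (norm (W i - u))\<^sup>2 - (norm (W (Suc i) - u))\<^sup>2 + \<eta>\<^sup>2 * G\<^sup>2"
    if "i < t" for i
  proof -
    have "dist (closest_point C (W i - \<eta> *\<^sub>R v i)) (closest_point C u) \<le> dist (W i - \<eta> *\<^sub>R v i) u"
      using C by (intro closest_point_lipschitz) auto
    then have "norm (W (Suc i) - u) \<le> norm (W i - \<eta> *\<^sub>R v i - u)"
      using C by (simp add: closest_point_self dist_norm W_def v_def)
    then have "(norm (W (Suc i) - u))\<^sup>2 \<le> (norm (W i - \<eta> *\<^sub>R v i - u))\<^sup>2"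
      by (intro power_mono) auto
    also have "\<dots> = (norm (W i - u))\<^sup>2 - 2 * \<eta> * (v i \<bullet> (W i - u)) + \<eta>\<^sup>2 * (norm (v i))\<^sup>2"
      unfolding power2_norm_eq_inner by (simp add: inner_diff_left inner_diff_right inner_commute power2_eq_square algebra_simps)
    also have "\<eta>\<^sup>2 * (norm (v i))\<^sup>2 \<le> \<eta>\<^sup>2 * G\<^sup>2"
      using bound[OF that] unfolding v_def W_def by (intro mult_left_mono power_mono) auto
    finally show ?thesis by simp
  qed
  have "2 * \<eta> * (\<Sum>i<t. v i \<bullet> (W i - u)) = (\<Sum>i<t. 2 * \<eta> * (v i \<bullet> (W i - u)))"
    by (simp add: sum_distrib_left)
  also have "\<dots> \<le> (\<Sum>i<t. (norm (W i - u))\<^sup>2 - (norm (W (Suc i) - u))\<^sup>2 + \<eta>\<^sup>2 * G\<^sup>2)"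
    using step by (intro sum_mono) auto
  also have "\<dots> = (norm (W 0 - u))\<^sup>2 - (norm (W t - u))\<^sup>2 + real t * (\<eta>\<^sup>2 * G\<^sup>2)"
    using sum_lessThan_telescope'[of "\<lambda>i. (norm (W i - u))\<^sup>2" t] by (simp add: sum.distrib)
  also have "\<dots> \<le> (norm (w - u))\<^sup>2 + real t * (\<eta>\<^sup>2 * G\<^sup>2)" by (simp add: W_def)
  finally have "(\<Sum>i<t. v i \<bullet> (W i - u)) \<le> ((norm (w - u))\<^sup>2 + real t * (\<eta>\<^sup>2 * G\<^sup>2)) / (2 * \<eta>)"
    using \<eta> by (simp add: field_simps)
  also have "\<dots> = (norm (w - u))\<^sup>2 / (2 * \<eta>) + \<eta> * real t * G\<^sup>2 / 2"
    using \<eta> by (simp add: field_simps power2_eq_square)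
  finally show ?thesis by (simp add: v_def W_def)
qed

section \<open>Exponential moments of adapted sums\<close>

text \<open>This replaces conditioning on the past: if \<open>h\<close> combines a quantity that ignores coordinate \<open>j\<close> with
  the coordinate itself, the inner integral on the right holds the former fixed and averages over a
  fresh sample.\<close>

lemma (in prob_space) nn_integral_PiM_resample:
  fixes j :: 'i
  defines "Q \<equiv> \<Pi>\<^sub>M i\<in>(UNIV :: 'i set). M"
  assumes [measurable]: "h \<in> borel_measurable Q"
  shows "(\<integral>\<^sup>+y. h y \<partial>Q) = (\<integral>\<^sup>+y. (\<integral>\<^sup>+x. h (y(j := x)) \<partial>M) \<partial>Q)"
proof -
  interpret Q: prob_space Q unfolding Q_def by (rule prob_space_PiM) (rule prob_space_axioms)
  interpret pair_sigma_finite M Q ..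
  have [measurable]: "(\<lambda>(x, y). y(j := x)) \<in> measurable (M \<Otimes>\<^sub>M Q) Q"
    unfolding Q_def case_prod_unfold by (rule measurable_fun_upd[where J = UNIV]) auto
  have "Q = distr (M \<Otimes>\<^sub>M Q) Q (\<lambda>(x, y). y(j := x))"
    using distr_pair_PiM_eq_PiM[of UNIV "\<lambda>_. M" j] prob_space_axioms by (simp add: Q_def)
  then have "(\<integral>\<^sup>+y. h y \<partial>Q) = (\<integral>\<^sup>+y. h y \<partial>distr (M \<Otimes>\<^sub>M Q) Q (\<lambda>(x, y). y(j := x)))" by simp
  also have "\<dots> = (\<integral>\<^sup>+z. h (case z of (x, y) \<Rightarrow> y(j := x)) \<partial>(M \<Otimes>\<^sub>M Q))"
    by (rule nn_integral_distr) auto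
  also have "\<dots> = (\<integral>\<^sup>+y. (\<integral>\<^sup>+x. h (y(j := x)) \<partial>M) \<partial>Q)"
    by (subst nn_integral_snd[symmetric]) auto
  finally show ?thesis .
qed

text \<open>Here \<open>N i\<close> may use the sample \<open>\<iota> i\<close> and anything that ignores the later samples
  \<open>\<iota> j\<close> with \<open>i < j\<close>. Resampling coordinate \<open>\<iota> n\<close> therefore leaves the
  earlier summands alone, and their factor comes out of the inner integral.\<close>

lemma (in prob_space) nn_integral_exp_adapted_sum_le:
  fixes N :: "nat \<Rightarrow> ('i \<Rightarrow> 'a) \<Rightarrow> real" and \<iota> :: "nat \<Rightarrow> 'i"
  defines "Q \<equiv> \<Pi>\<^sub>M i\<in>(UNIV :: 'i set). M"
  assumes meas: "\<And>i. i < n \<Longrightarrow> N i \<in> borel_measurable Q"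
    and adapted: "\<And>i j y x. i < j \<Longrightarrow> j < n \<Longrightarrow> N i (y(\<iota> j := x)) = N i y"
    and mgf: "\<And>i y. i < n \<Longrightarrow> y \<in> space Q \<Longrightarrow> (\<integral>\<^sup>+x. exp (N i (y(\<iota> i := x))) \<partial>M) \<le> B"
  shows "(\<integral>\<^sup>+y. exp (\<Sum>i<n. N i y) \<partial>Q) \<le> B ^ n"
  using meas adapted mgf
proof (induction n)
  case 0
  interpret Q: prob_space Q unfolding Q_def by (rule prob_space_PiM) (rule prob_space_axioms)
  show ?case by (simp add: Q.emeasure_space_1)
next
  case (Suc n)
  note [measurable] = Suc.prems(1)
  have [measurable]: "(\<lambda>y. \<Sum>i<n. N i y) \<in> borel_measurable Q"
    using Suc.prems(1) by (intro borel_measurable_sum) auto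
  have "(\<integral>\<^sup>+y. exp (\<Sum>i<Suc n. N i y) \<partial>Q)
      = (\<integral>\<^sup>+y. (\<integral>\<^sup>+x. exp (\<Sum>i<Suc n. N i (y(\<iota> n := x))) \<partial>M) \<partial>Q)"
    unfolding Q_def
    by (rule nn_integral_PiM_resample) (use Suc.prems(1) in \<open>auto simp: Q_def intro!: borel_measurable_sum\<close>)
  also have "\<dots> \<le> (\<integral>\<^sup>+y. exp (\<Sum>i<n. N i y) * B \<partial>Q)"
  proof (rule nn_integral_mono)
    fix y assume y: "y \<in> space Q"
    have [measurable]: "(\<lambda>x. y(\<iota> n := x)) \<in> measurable M Q"
      using y unfolding Q_def by (intro measurable_fun_upd[where J = UNIV] measurable_const) auto
    have past: "(\<Sum>i<n. N i (y(\<iota> n := x))) = (\<Sum>i<n. N i y)" for x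
      by (rule sum.cong[OF refl Suc.prems(2)]) auto
    have "(\<integral>\<^sup>+x. exp (\<Sum>i<Suc n. N i (y(\<iota> n := x))) \<partial>M)
        = (\<integral>\<^sup>+x. ennreal (exp (\<Sum>i<n. N i y)) * ennreal (exp (N n (y(\<iota> n := x)))) \<partial>M)"
      by (intro nn_integral_cong) (simp add: past exp_add ennreal_mult')
    also have "\<dots> = exp (\<Sum>i<n. N i y) * (\<integral>\<^sup>+x. exp (N n (y(\<iota> n := x))) \<partial>M)"
      by (rule nn_integral_cmult) measurable
    also have "\<dots> \<le> exp (\<Sum>i<n. N i y) * B"
      by (rule mult_left_mono[OF Suc.prems(3)[OF lessI y]]) simp
    finally show "(\<integral>\<^sup>+x. exp (\<Sum>i<Suc n. N i (y(\<iota> n := x))) \<partial>M) \<le> exp (\<Sum>i<n. N i y) * B" .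
  qed
  also have "\<dots> = (\<integral>\<^sup>+y. exp (\<Sum>i<n. N i y) \<partial>Q) * B"
    by (rule nn_integral_multc) measurable
  also have "\<dots> \<le> B ^ n * B"
    using Suc.prems by (intro mult_right_mono Suc.IH) auto
  finally show ?case by (simp add: mult.commute)
qed

lemma (in prob_space) adapted_sum_tail_le:
  fixes N :: "nat \<Rightarrow> ('i \<Rightarrow> 'a) \<Rightarrow> real" and \<iota> :: "nat \<Rightarrow> 'i"
  defines "Q \<equiv> \<Pi>\<^sub>M i\<in>(UNIV :: 'i set). M"
  assumes meas: "\<And>i. i < n \<Longrightarrow> N i \<in> borel_measurable Q"
    and adapted: "\<And>i j y x. i < j \<Longrightarrow> j < n \<Longrightarrow> N i (y(\<iota> j := x)) = N i y"
    and mgf: "\<And>i y. i < n \<Longrightarrow> y \<in> space Q \<Longrightarrow>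
      (\<integral>\<^sup>+x. exp (a * N i (y(\<iota> i := x))) \<partial>M) \<le> ennreal (exp b)"
    and a: "0 < a"
  shows "measure Q {y \<in> space Q. L < (\<Sum>i<n. N i y)} \<le> exp (real n * b - a * L)"
proof -
  interpret Q: prob_space Q unfolding Q_def by (rule prob_space_PiM) (rule prob_space_axioms)
  have [measurable]: "(\<lambda>y. \<Sum>i<n. a * N i y) \<in> borel_measurable Q" "(\<lambda>y. \<Sum>i<n. N i y) \<in> borel_measurable Q"
    using meas by (auto intro!: borel_measurable_sum borel_measurable_times)
  have int: "(\<integral>\<^sup>+y. exp (\<Sum>i<n. a * N i y) \<partial>Q) \<le> ennreal (exp b) ^ n"
    unfolding Q_def
  proof (rule nn_integral_exp_adapted_sum_le[where \<iota> = \<iota>])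
    show "(\<lambda>y. a * N i y) \<in> borel_measurable (\<Pi>\<^sub>M i\<in>UNIV. M)" if "i < n" for i
      using meas[OF that] unfolding Q_def by measurable
    show "a * N i (y(\<iota> j := x)) = a * N i y" if "i < j" "j < n" for i j y x
      using adapted[OF that] by simp
  qed (use mgf in \<open>auto simp: Q_def\<close>)
  have "emeasure Q {y \<in> space Q. L < (\<Sum>i<n. N i y)}
      \<le> emeasure Q {y \<in> space Q. 1 \<le> ennreal (exp (- (a * L))) * ennreal (exp (\<Sum>i<n. a * N i y))}"
  proof (rule emeasure_mono)
    show "{y \<in> space Q. L < (\<Sum>i<n. N i y)}
      \<subseteq> {y \<in> space Q. 1 \<le> ennreal (exp (- (a * L))) * ennreal (exp (\<Sum>i<n. a * N i y))}"
    proof (safe)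
      fix y assume "L < (\<Sum>i<n. N i y)"
      then have "a * L \<le> a * (\<Sum>i<n. N i y)" using a by (intro mult_left_mono) auto
      then have "1 \<le> exp (- (a * L)) * exp (\<Sum>i<n. a * N i y)"
        by (simp add: sum_distrib_left flip: exp_add)
      then show "1 \<le> ennreal (exp (- (a * L))) * ennreal (exp (\<Sum>i<n. a * N i y))"
        by (simp flip: ennreal_mult')
    qed
  qed measurable
  also have "\<dots> \<le> ennreal (exp (- (a * L))) * (\<integral>\<^sup>+y. ennreal (exp (\<Sum>i<n. a * N i y)) * indicator (space Q) y \<partial>Q)"
    by (rule nn_integral_Markov_inequality) auto
  also have "(\<integral>\<^sup>+y. ennreal (exp (\<Sum>i<n. a * N i y)) * indicator (space Q) y \<partial>Q) = (\<integral>\<^sup>+y. exp (\<Sum>i<n. a * N i y) \<partial>Q)"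
    by (rule nn_integral_cong) simp
  also have "ennreal (exp (- (a * L))) * \<dots> \<le> ennreal (exp (- (a * L))) * ennreal (exp b) ^ n"
    by (rule mult_left_mono[OF int]) simp
  also have "\<dots> = ennreal (exp (real n * b - a * L))"
    by (simp add: ennreal_power exp_diff exp_minus field_simps flip: exp_of_nat_mult ennreal_mult')
  finally show ?thesis by (simp add: Q.emeasure_eq_measure)
qed

section \<open>The objective and its growth\<close>

locale bounded_stochastic_convex_problem = stochastic_convex_problem D \<K> f g
  for D :: "'x measure" and \<K> :: "'a::euclidean_space set" and f g +
  fixes G :: real
  assumes G_pos: "0 < G"
    and norm_g_le: "\<And>w x. w \<in> \<K> \<Longrightarrow> x \<in> space D \<Longrightarrow> norm (g w x) \<le> G"
begin

abbreviation F :: "'a \<Rightarrow> real" where "F \<equiv> objective D f"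
abbreviation F_opt :: real where "F_opt \<equiv> optimal_value \<K> F"
abbreviation \<K>_opt :: "'a set" where "\<K>_opt \<equiv> optimal_set \<K> F"

definition mean_subgradient :: "'a \<Rightarrow> 'a" where
  "mean_subgradient w = (\<integral>x. g w x \<partial>D)"

lemma measurable_g_compose [measurable (raw)]:
  assumes "W \<in> borel_measurable M" "X \<in> measurable M D"
  shows "(\<lambda>z. g (W z) (X z)) \<in> borel_measurable M"
  using measurable_compose[OF measurable_Pair[OF assms] measurable_g] by simp

lemma measurable_mean_subgradient [measurable]: "mean_subgradient \<in> borel_measurable borel"
  unfolding mean_subgradient_def by measurable

lemma integrable_g: "w \<in> \<K> \<Longrightarrow> integrable D (g w)"
  by (intro integrable_const_bound[where B = G] AE_I2 norm_g_le) auto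

lemma norm_mean_subgradient_le:
  assumes "w \<in> \<K>"
  shows "norm (mean_subgradient w) \<le> G"
proof -
  have "norm (mean_subgradient w) \<le> (\<integral>x. norm (g w x) \<partial>D)"
    unfolding mean_subgradient_def by (rule integral_norm_bound)
  also have "\<dots> \<le> (\<integral>x. G \<partial>D)"
    using assms by (intro integral_mono integrable_norm integrable_g norm_g_le) auto
  finally show ?thesis by (simp add: prob_space)
qed

lemma objective_subgradient:
  assumes "w \<in> \<K>" "u \<in> \<K>"
  shows "F w + mean_subgradient w \<bullet> (u - w) \<le> F u"
proof -
  have "F w + mean_subgradient w \<bullet> (u - w) = (\<integral>x. f w x + g w x \<bullet> (u - w) \<partial>D)"
    using assms by (simp add: objective_def mean_subgradient_def integrable_f integrable_g)
  also have "\<dots> \<le> F u"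
    unfolding objective_def using assms subgradient_g
    by (intro integral_mono) (auto simp: integrable_f integrable_g subgradient_def)
  finally show ?thesis .
qed

text \<open>Subgradients are available at every feasible point, including the boundary, where convexity alone
  would not give continuity.\<close>

lemma objective_lipschitz: "G-lipschitz_on \<K> F"
proof (rule lipschitz_onI)
  have *: "F w - F u \<le> G * dist w u" if "w \<in> \<K>" "u \<in> \<K>" for w u
  proof -
    have "F w - F u \<le> mean_subgradient w \<bullet> (w - u)"
      using objective_subgradient[OF that] by (simp add: inner_diff_right)
    also have "\<dots> \<le> norm (mean_subgradient w) * norm (w - u)" by (rule norm_cauchy_schwarz)
    also have "\<dots> \<le> G * dist w u"
      unfolding dist_norm using that by (intro mult_right_mono norm_mean_subgradient_le) auto
    finally show ?thesis .
  qed
  show "dist (F w) (F u) \<le> G * dist w u" if "w \<in> \<K>" "u \<in> \<K>" for w u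
    using *[OF that] *[OF that(2,1)] by (simp add: dist_real_def dist_commute abs_le_iff)
qed (use G_pos in simp)

lemma continuous_on_objective: "continuous_on \<K> F"
  by (rule lipschitz_on_continuous_on[OF objective_lipschitz])

lemma convex_on_objective: "convex_on \<K> F"
  unfolding convex_on_def
proof (intro conjI convex_feasible ballI allI impI)
  fix x y and u v :: real
  assume xy: "x \<in> \<K>" "y \<in> \<K>" and uv: "0 \<le> u" "0 \<le> v" "u + v = 1"
  define z where "z = u *\<^sub>R x + v *\<^sub>R y"
  define m where "m = mean_subgradient z"
  have z: "z \<in> \<K>" unfolding z_def using xy uv by (intro convexD[OF convex_feasible])
  have "F z = u * (F z + m \<bullet> (x - z)) + v * (F z + m \<bullet> (y - z))"
  proof -
    have "u *\<^sub>R (x - z) + v *\<^sub>R (y - z) = z - (u + v) *\<^sub>R z"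
      by (simp add: z_def algebra_simps)
    then have "m \<bullet> (u *\<^sub>R (x - z) + v *\<^sub>R (y - z)) = 0" using uv by simp
    then have "u * (m \<bullet> (x - z)) + v * (m \<bullet> (y - z)) = 0" by (simp only: inner_add_right inner_scaleR_right)
    moreover have "u * F z + v * F z = F z" using uv by (simp flip: distrib_right)
    ultimately show ?thesis by (simp add: distrib_left)
  qed
  also have "\<dots> \<le> u * F x + v * F y"
    unfolding m_def using uv xy z by (intro add_mono mult_left_mono objective_subgradient) auto
  finally show "F (u *\<^sub>R x + v *\<^sub>R y) \<le> u * F x + v * F y" by (simp add: z_def)
qed

lemma optimal_value_le: "w \<in> \<K> \<Longrightarrow> F_opt \<le> F w"
  and optimal_set_eq: "\<K>_opt = {w \<in> \<K>. F w \<le> F_opt}"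
proof -
  obtain v where v: "v \<in> \<K>" "\<And>w. w \<in> \<K> \<Longrightarrow> F v \<le> F w"
    using optimal_set_nonempty unfolding optimal_set_def is_arg_min_linorder by auto
  have eq: "F_opt = F v"
    unfolding optimal_value_def by (rule cInf_eq_minimum) (use v in auto)
  show "F_opt \<le> F w" if "w \<in> \<K>" for w using v that eq by simp
  show "\<K>_opt = {w \<in> \<K>. F w \<le> F_opt}"
    unfolding optimal_set_def is_arg_min_linorder eq using v by (auto intro: order_trans)
qed

lemma objective_optimal: "v \<in> \<K>_opt \<Longrightarrow> v \<in> \<K> \<and> F v = F_opt"
  using optimal_value_le[of v] by (auto simp: optimal_set_eq)

lemma closed_optimal_set: "closed \<K>_opt"
proof -
  have "\<K>_opt = \<K> \<inter> F -` {..F_opt}" by (auto simp: optimal_set_eq)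
  then show ?thesis
    using continuous_closed_preimage[OF continuous_on_objective closed_feasible closed_atMost] by simp
qed

lemma convex_optimal_set: "convex \<K>_opt"
  unfolding optimal_set_eq
proof (rule convexI)
  fix x y and u v :: real
  assume *: "x \<in> {w \<in> \<K>. F w \<le> F_opt}" "y \<in> {w \<in> \<K>. F w \<le> F_opt}" "0 \<le> u" "0 \<le> v" "u + v = 1"
  have "F (u *\<^sub>R x + v *\<^sub>R y) \<le> u * F x + v * F y"
    using convex_on_objective * unfolding convex_on_def by blast
  also have "\<dots> \<le> u * F_opt + v * F_opt" using * by (intro add_mono mult_left_mono) auto
  also have "\<dots> = F_opt" using * by (simp flip: distrib_right)
  finally show "u *\<^sub>R x + v *\<^sub>R y \<in> {w \<in> \<K>. F w \<le> F_opt}"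
    using * convexD[OF convex_feasible] by auto
qed

text \<open>The point at gap at most \<open>\<epsilon>\<close> with which a stage started at \<open>w\<close> is compared. It is \<open>w\<close> itself if the gap of
  \<open>w\<close> is at most \<open>\<epsilon>\<close>. Compared with the closest point to \<open>w\<close> of the sublevel set, it has an explicit
  formula that is continuous in \<open>w\<close>, and it lies on the segment to the closest optimal point.\<close>

definition reference_point :: "real \<Rightarrow> 'a \<Rightarrow> 'a" where
  "reference_point \<epsilon> w =
     closest_point \<K>_opt w + (\<epsilon> / max \<epsilon> (F w - F_opt)) *\<^sub>R (w - closest_point \<K>_opt w)"

lemma continuous_on_reference_point:
  assumes "0 < \<epsilon>"
  shows "continuous_on \<K> (reference_point \<epsilon>)"
proof -
  have "max \<epsilon> (F w - F_opt) \<noteq> 0" for w using assms by (simp add: max_def)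
  then show ?thesis
    unfolding reference_point_def
    using closed_optimal_set convex_optimal_set optimal_set_nonempty
    by (intro continuous_intros continuous_on_objective continuous_on_closest_point) auto
qed

lemma
  assumes \<epsilon>: "0 < \<epsilon>" and w: "w \<in> \<K>"
  shows reference_point_feasible: "reference_point \<epsilon> w \<in> \<K>"
    and objective_reference_point: "F (reference_point \<epsilon> w) \<le> F_opt + \<epsilon>"
proof -
  define v where "v = closest_point \<K>_opt w"
  define l where "l = \<epsilon> / max \<epsilon> (F w - F_opt)"
  have v: "v \<in> \<K>" "F v = F_opt"
    using objective_optimal closest_point_in_set[OF closed_optimal_set optimal_set_nonempty, of w]
    by (auto simp: v_def)
  have l: "0 \<le> l" "l \<le> 1" using \<epsilon> by (auto simp: l_def divide_simps)
  have u: "reference_point \<epsilon> w = (1 - l) *\<^sub>R v + l *\<^sub>R w"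
    by (simp add: reference_point_def v_def l_def algebra_simps)
  show "reference_point \<epsilon> w \<in> \<K>"
    unfolding u using v w l by (intro convexD[OF convex_feasible]) auto
  have "F (reference_point \<epsilon> w) \<le> (1 - l) * F v + l * F w"
    unfolding u using l v w by (intro convex_onD[OF convex_on_objective])
  also have "\<dots> = F_opt + l * (F w - F_opt)" by (simp add: v algebra_simps)
  also have "l * (F w - F_opt) \<le> l * max \<epsilon> (F w - F_opt)" using l by (intro mult_left_mono) auto
  also have "\<dots> = \<epsilon>" using \<epsilon> by (simp add: l_def max_def)
  finally show "F (reference_point \<epsilon> w) \<le> F_opt + \<epsilon>" by simp
qed

text \<open>With \<open>l\<close> the fraction of the segment from \<open>v\<close> to \<open>w\<close> at which the reference point \<open>u\<close> lies,
  \<open>norm (u - v) = l * norm (w - v)\<close> and \<open>norm (w - u) = (1 - l) * norm (w - v)\<close>. Local growth applies to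
  the first length, since \<open>v\<close> is the closest optimal point of \<open>u\<close> too. The ratio
  \<open>(1 - l) / l\<close> is at most \<open>e / \<epsilon>\<close>.\<close>

lemma norm_diff_reference_point_le:
  assumes growth: "local_growth \<K> F \<epsilon>' c \<theta>" and \<epsilon>: "0 < \<epsilon>" "\<epsilon> \<le> \<epsilon>'" and "0 \<le> \<theta>" "0 \<le> c"
    and w: "w \<in> \<K>" and e: "0 \<le> e" "F w - F_opt \<le> e + \<epsilon>"
  shows "norm (w - reference_point \<epsilon> w) \<le> c * e / \<epsilon> powr (1 - \<theta>)"
proof (cases "F w - F_opt \<le> \<epsilon>")
  case True
  then have "reference_point \<epsilon> w = w" using \<epsilon> by (simp add: reference_point_def max_def)
  then show ?thesis using assms by simp
next
  case False
  define v where "v = closest_point \<K>_opt w"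
  define u where "u = reference_point \<epsilon> w"
  define m where "m = F w - F_opt"
  define l where "l = \<epsilon> / m"
  have m: "\<epsilon> < m" using False by (simp add: m_def)
  have l: "0 < l" "l \<le> 1" using m \<epsilon> by (auto simp: l_def divide_simps)
  have u: "u = v + l *\<^sub>R (w - v)"
    using m by (simp add: u_def reference_point_def v_def l_def max_def m_def)
  have uK: "u \<in> \<K>" "F u \<le> F_opt + \<epsilon>" "F_opt \<le> F u"
    using reference_point_feasible[OF \<epsilon>(1) w] objective_reference_point[OF \<epsilon>(1) w] optimal_value_le
    by (auto simp: u_def)
  have "closest_point \<K>_opt u = v"
    unfolding u v_def using l closed_optimal_set convex_optimal_set optimal_set_nonempty
    by (intro closest_point_on_segment_to_closest_point) auto
  then have "norm (u - v) \<le> c * (F u - F_opt) powr \<theta>"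
    using growth uK \<epsilon> unfolding local_growth_def sublevel_set_def by force
  also have "\<dots> \<le> c * \<epsilon> powr \<theta>"
    using uK assms by (intro mult_left_mono powr_mono2) auto
  finally have uv: "norm (u - v) \<le> c * \<epsilon> powr \<theta>" .
  have "w - u = (1 - l) *\<^sub>R (w - v)" by (simp add: u algebra_simps)
  then have "norm (w - u) = (1 - l) * norm (w - v)" using l by simp
  also have "\<dots> = (1 - l) / l * norm (u - v)" using l by (simp add: u)
  also have "(1 - l) / l = (m - \<epsilon>) / \<epsilon>" using m \<epsilon> by (simp add: l_def field_simps)
  also have "(m - \<epsilon>) / \<epsilon> * norm (u - v) \<le> e / \<epsilon> * (c * \<epsilon> powr \<theta>)"
    using m \<epsilon> e uv by (intro mult_mono divide_right_mono) (auto simp: m_def)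
  also have "\<dots> = c * e / \<epsilon> powr (1 - \<theta>)"
    using \<epsilon> by (simp add: powr_diff field_simps)
  finally show ?thesis by (simp add: u_def)
qed

end

section \<open>One stage with high probability\<close>

context bounded_stochastic_convex_problem
begin

text \<open>The noise is the centred version of \<open>g w x \<bullet> (u - w)\<close>, which stays within \<open>G * \<rho>\<close> of \<open>0\<close>, so
  Hoeffding's lemma applies with an interval of length \<open>2 * G * \<rho>\<close>.\<close>

lemma mgf_subgradient_noise_le:
  assumes w: "w \<in> \<K>" and a: "0 < a" and \<rho>: "norm (w - u) \<le> \<rho>"
  shows "(\<integral>\<^sup>+x. exp (a * ((mean_subgradient w - g w x) \<bullet> (w - u))) \<partial>D)
    \<le> ennreal (exp (a\<^sup>2 * (G\<^sup>2 * \<rho>\<^sup>2 / 2)))"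
proof -
  define h where "h = (\<lambda>x. g w x \<bullet> (u - w))"
  have "\<bar>h x\<bar> \<le> G * \<rho>" if "x \<in> space D" for x
  proof -
    have "\<bar>h x\<bar> \<le> norm (g w x) * norm (u - w)" unfolding h_def by (rule Cauchy_Schwarz_ineq2)
    also have "\<dots> \<le> G * \<rho>"
      using \<rho> G_pos norm_g_le[OF w that] by (intro mult_mono) (auto simp: norm_minus_commute)
    finally show ?thesis .
  qed
  then interpret interval_bounded_random_variable D h "- (G * \<rho>)" "G * \<rho>"
    by unfold_locales (auto simp: h_def abs_le_iff minus_le_iff)
  have E: "expectation h = mean_subgradient w \<bullet> (u - w)"
    unfolding h_def mean_subgradient_def by (simp add: integrable_g w)
  have "(\<integral>\<^sup>+x. exp (a * (h x - expectation h)) \<partial>D) \<le> ennreal (exp (a\<^sup>2 * (G * \<rho> - - (G * \<rho>))\<^sup>2 / 8))"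
    by (rule Hoeffdings_lemma_nn_integral[OF a])
  moreover have "h x - expectation h = (mean_subgradient w - g w x) \<bullet> (w - u)" for x
    by (simp only: E) (simp add: h_def inner_diff_left inner_diff_right)
  moreover have "a\<^sup>2 * (G * \<rho> - - (G * \<rho>))\<^sup>2 / 8 = a\<^sup>2 * (G\<^sup>2 * \<rho>\<^sup>2 / 2)"
    by (simp add: power2_eq_square)
  ultimately show ?thesis by (simp only:)
qed

lemma objective_psg_average_le:
  assumes C: "closed C" "convex C" "C \<subseteq> \<K>" "w \<in> C" "u \<in> C" and x: "\<And>i. x i \<in> space D"
    and \<eta>: "0 < \<eta>" and t: "0 < t"
  defines "W \<equiv> psg_iterate C g x \<eta> w"
  shows "F (psg_average C g x \<eta> w t) - F u \<le> (norm (w - u))\<^sup>2 / (2 * \<eta> * real t) + \<eta> * G\<^sup>2 / 2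
    + (\<Sum>i<t. (mean_subgradient (W i) - g (W i) (x (Suc i))) \<bullet> (W i - u)) / real t"
proof -
  have W: "W i \<in> \<K>" for i unfolding W_def by (rule subsetD[OF C(3) psg_iterate_in[OF C(1,4)]])
  have "F (psg_average C g x \<eta> w t) \<le> (\<Sum>i<t. 1 / real t * F (W i))"
    unfolding psg_average_eq W_def[symmetric] using t W by (intro convex_on_sum[OF _ _ convex_on_objective]) auto
  also have "\<dots> = F u + (\<Sum>i<t. F (W i) - F u) / real t"
    using t by (simp add: sum_subtractf sum_divide_distrib[symmetric] field_simps)
  finally have "F (psg_average C g x \<eta> w t) - F u \<le> (\<Sum>i<t. F (W i) - F u) / real t" by simp
  also have "\<dots> \<le> (\<Sum>i<t. g (W i) (x (Suc i)) \<bullet> (W i - u)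
      + (mean_subgradient (W i) - g (W i) (x (Suc i))) \<bullet> (W i - u)) / real t"
  proof (intro divide_right_mono sum_mono)
    fix i
    show "F (W i) - F u \<le> g (W i) (x (Suc i)) \<bullet> (W i - u)
      + (mean_subgradient (W i) - g (W i) (x (Suc i))) \<bullet> (W i - u)"
      using objective_subgradient[OF W, of u i] C by (auto simp: inner_diff_left inner_diff_right)
  qed simp
  also have "\<dots> = (\<Sum>i<t. g (W i) (x (Suc i)) \<bullet> (W i - u)) / real t
      + (\<Sum>i<t. (mean_subgradient (W i) - g (W i) (x (Suc i))) \<bullet> (W i - u)) / real t"
    by (simp add: sum.distrib add_divide_distrib)
  also have "(\<Sum>i<t. g (W i) (x (Suc i)) \<bullet> (W i - u)) / real t
      \<le> ((norm (w - u))\<^sup>2 / (2 * \<eta>) + \<eta> * real t * G\<^sup>2 / 2) / real t"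
    unfolding W_def
    by (intro divide_right_mono psg_regret C \<eta> norm_g_le x W[unfolded W_def]) auto
  also have "\<dots> = (norm (w - u))\<^sup>2 / (2 * \<eta> * real t) + \<eta> * G\<^sup>2 / 2"
    using t \<eta> by (simp add: field_simps)
  finally show ?thesis by simp
qed

lemma measurable_psg_iterate:
  assumes [measurable]: "W\<^sub>0 \<in> borel_measurable M" "\<And>\<tau>. x \<tau> \<in> measurable M D"
    and W0: "\<And>y. y \<in> space M \<Longrightarrow> W\<^sub>0 y \<in> \<K>" and r: "0 < r"
  shows "(\<lambda>y. psg_iterate (\<K> \<inter> cball (W\<^sub>0 y) r) g (\<lambda>\<tau>. x \<tau> y) \<eta> (W\<^sub>0 y) i) \<in> borel_measurable M"
proof (induction i)
  case (Suc i)
  note [measurable] = Suc.IH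
  show ?case
    by (simp, rule borel_measurable_closest_point_trust_region[OF closed_feasible convex_feasible r])
       (use W0 in measurable)
qed simp

lemma measurable_psg_average:
  assumes "W\<^sub>0 \<in> borel_measurable M" "\<And>\<tau>. x \<tau> \<in> measurable M D"
    and "\<And>y. y \<in> space M \<Longrightarrow> W\<^sub>0 y \<in> \<K>" and "0 < r"
  shows "(\<lambda>y. psg_average (\<K> \<inter> cball (W\<^sub>0 y) r) g (\<lambda>\<tau>. x \<tau> y) \<eta> (W\<^sub>0 y) t) \<in> borel_measurable M"
  unfolding psg_average_eq
  by (intro borel_measurable_sum borel_measurable_scaleR borel_measurable_const measurable_psg_iterate assms)

text \<open>The start \<open>W\<^sub>0\<close> and the comparison point \<open>U\<close> are random, but they ignore the samples of the
  stage. Iterate \<open>i\<close> uses only the samples \<open>\<iota> 1, \<dots>, \<iota> i\<close>, and noise term \<open>i\<close> pairs it with the sample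
  \<open>\<iota> (i + 1)\<close>, so the noise is adapted. Both the iterates and \<open>U\<close> lie in the ball of radius \<open>r\<close>, hence
  at distance at most \<open>2 * r\<close>.\<close>

lemma stage_tail_le:
  fixes \<iota> :: "nat \<Rightarrow> 'i" and \<eta> :: real and W\<^sub>0 U :: "('i \<Rightarrow> 'x) \<Rightarrow> 'a"
  defines "Q \<equiv> \<Pi>\<^sub>M i\<in>(UNIV :: 'i set). D"
  assumes W0: "W\<^sub>0 \<in> borel_measurable Q" "\<And>y. y \<in> space Q \<Longrightarrow> W\<^sub>0 y \<in> \<K>"
    and U: "U \<in> borel_measurable Q" "\<And>y. y \<in> space Q \<Longrightarrow> U y \<in> \<K> \<inter> cball (W\<^sub>0 y) r"
    and \<iota>: "inj \<iota>"
    and past: "\<And>y \<tau> x. W\<^sub>0 (y(\<iota> \<tau> := x)) = W\<^sub>0 y" "\<And>y \<tau> x. U (y(\<iota> \<tau> := x)) = U y"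
    and r: "0 < r" and a: "0 < a"
  defines "W \<equiv> \<lambda>y. psg_iterate (\<K> \<inter> cball (W\<^sub>0 y) r) g (\<lambda>\<tau>. y (\<iota> \<tau>)) \<eta> (W\<^sub>0 y)"
  defines "N \<equiv> \<lambda>i y. (mean_subgradient (W y i) - g (W y i) (y (\<iota> (Suc i)))) \<bullet> (W y i - U y)"
  shows "\<And>i. N i \<in> borel_measurable Q"
    and "measure Q {y \<in> space Q. L < (\<Sum>i<t. N i y)} \<le> exp (real t * (2 * a\<^sup>2 * G\<^sup>2 * r\<^sup>2) - a * L)"
proof -
  note [measurable] = W0(1) U(1)
  have [measurable]: "(\<lambda>y. y (\<iota> \<tau>)) \<in> measurable Q D" for \<tau>
    unfolding Q_def by (rule measurable_component_singleton) simp
  have [measurable]: "(\<lambda>y. W y i) \<in> borel_measurable Q" for i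
    unfolding W_def by (rule measurable_psg_iterate) (use W0 r in auto)
  have N: "N i \<in> borel_measurable Q" for i unfolding N_def by measurable
  then show "N i \<in> borel_measurable Q" for i .
  have W_in: "W y i \<in> \<K> \<inter> cball (W\<^sub>0 y) r" if "y \<in> space Q" for y i
    unfolding W_def using W0(2)[OF that] closed_feasible r by (intro psg_iterate_in) auto
  have W_past: "W (y(\<iota> (Suc j) := x)) i = W y i" if "i \<le> j" for i j y x
    unfolding W_def past using that \<iota> by (intro psg_iterate_cong) (auto dest: injD)
  show "measure Q {y \<in> space Q. L < (\<Sum>i<t. N i y)} \<le> exp (real t * (2 * a\<^sup>2 * G\<^sup>2 * r\<^sup>2) - a * L)"
    unfolding Q_def
  proof (rule adapted_sum_tail_le[where \<iota> = "\<lambda>i. \<iota> (Suc i)"])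
    show "N i (y(\<iota> (Suc j) := x)) = N i y" if "i < j" for i j y x
      using that \<iota> W_past[of i j y x] by (auto simp: N_def past dest: injD)
    show "N i \<in> borel_measurable (\<Pi>\<^sub>M i\<in>UNIV. D)" for i using N by (simp add: Q_def)
    fix i y assume "y \<in> space (\<Pi>\<^sub>M i\<in>(UNIV :: 'i set). D)"
    then have y: "y \<in> space Q" by (simp add: Q_def)
    have "norm (W y i - U y) \<le> dist (W y i) (W\<^sub>0 y) + dist (W\<^sub>0 y) (U y)"
      by (simp add: dist_triangle flip: dist_norm)
    also have "\<dots> \<le> 2 * r" using W_in[OF y, of i] U(2)[OF y] by (auto simp: dist_commute)
    finally have "(\<integral>\<^sup>+x. exp (a * ((mean_subgradient (W y i) - g (W y i) x) \<bullet> (W y i - U y))) \<partial>D)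
        \<le> ennreal (exp (a\<^sup>2 * (G\<^sup>2 * (2 * r)\<^sup>2 / 2)))"
      using W_in[OF y] a by (intro mgf_subgradient_noise_le) auto
    also have "a\<^sup>2 * (G\<^sup>2 * (2 * r)\<^sup>2 / 2) = 2 * a\<^sup>2 * G\<^sup>2 * r\<^sup>2" by (simp add: power_mult_distrib)
    finally show "(\<integral>\<^sup>+x. exp (a * N i (y(\<iota> (Suc i) := x))) \<partial>D) \<le> ennreal (exp (2 * a\<^sup>2 * G\<^sup>2 * r\<^sup>2))"
      by (simp only: N_def past W_past[OF order_refl] fun_upd_same)
  qed (rule a)
qed

text \<open>The step size \<open>e / (3 * G\<^sup>2)\<close> makes the subgradient norms contribute \<open>e / 6\<close>. The \<open>9\<close> in the number
  of steps makes the start distance contribute at most \<open>e / 6\<close>, and the \<open>1728\<close> bounds the probability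
  that the noise contributes more than \<open>e / 6\<close>. The conclusion is stated with an event \<open>B\<close> that absorbs
  the probability, so that all later arguments are pointwise.\<close>

lemma stage_high_probability:
  fixes \<iota> :: "nat \<Rightarrow> 'i" and W\<^sub>0 U :: "('i \<Rightarrow> 'x) \<Rightarrow> 'a"
  defines "Q \<equiv> \<Pi>\<^sub>M i\<in>(UNIV :: 'i set). D"
  assumes W0: "W\<^sub>0 \<in> borel_measurable Q" "\<And>y. y \<in> space Q \<Longrightarrow> W\<^sub>0 y \<in> \<K>"
    and U: "U \<in> borel_measurable Q" "\<And>y. y \<in> space Q \<Longrightarrow> U y \<in> \<K> \<inter> cball (W\<^sub>0 y) r"
    and \<iota>: "inj \<iota>"
    and past: "\<And>y \<tau> x. W\<^sub>0 (y(\<iota> \<tau> := x)) = W\<^sub>0 y" "\<And>y \<tau> x. U (y(\<iota> \<tau> := x)) = U y"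
    and r: "0 < r" and e: "0 < e" and \<delta>: "0 < \<delta>" "\<delta> < 1"
    and t: "max 9 (1728 * ln (1 / \<delta>)) * (G * r / e)\<^sup>2 \<le> real t"
  shows "\<exists>B \<in> sets Q. measure Q B \<le> \<delta> \<and> (\<forall>y \<in> space Q - B.
    F (psg_average (\<K> \<inter> cball (W\<^sub>0 y) r) g (\<lambda>\<tau>. y (\<iota> \<tau>)) (e / (3 * G\<^sup>2)) (W\<^sub>0 y) t) - F (U y) \<le> e / 2)"
proof -
  define \<eta> where "\<eta> = e / (3 * G\<^sup>2)"
  define W where "W = (\<lambda>y. psg_iterate (\<K> \<inter> cball (W\<^sub>0 y) r) g (\<lambda>\<tau>. y (\<iota> \<tau>)) \<eta> (W\<^sub>0 y))"
  define N where "N = (\<lambda>i y. (mean_subgradient (W y i) - g (W y i) (y (\<iota> (Suc i)))) \<bullet> (W y i - U y))"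
  define B where "B = {y \<in> space Q. real t * e / 6 < (\<Sum>i<t. N i y)}"
  \<comment> \<open>The minimiser of the exponent \<open>real t * (2 * a\<^sup>2 * G\<^sup>2 * r\<^sup>2) - a * (real t * e / 6)\<close>.\<close>
  define a where "a = e / (24 * G\<^sup>2 * r\<^sup>2)"
  have \<eta>: "0 < \<eta>" and a: "0 < a" using e G_pos r by (auto simp: \<eta>_def a_def)
  have q: "0 < (G * r / e)\<^sup>2" using e G_pos r by simp
  have "9 * (G * r / e)\<^sup>2 \<le> max 9 (1728 * ln (1 / \<delta>)) * (G * r / e)\<^sup>2"
    "1728 * ln (1 / \<delta>) * (G * r / e)\<^sup>2 \<le> max 9 (1728 * ln (1 / \<delta>)) * (G * r / e)\<^sup>2"
    using q by (intro mult_right_mono; simp)+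
  with t have t9: "9 * (G * r / e)\<^sup>2 \<le> real t" and tln: "1728 * ln (1 / \<delta>) * (G * r / e)\<^sup>2 \<le> real t"
    by linarith+
  have t0: "0 < t" using t9 q by (cases t) auto
  note tail = stage_tail_le[of W\<^sub>0 U r \<iota> a, OF W0[unfolded Q_def] U[unfolded Q_def] \<iota> past r a]
  have [measurable]: "N i \<in> borel_measurable Q" for i
    unfolding N_def W_def Q_def by (rule tail(1))
  have "B \<in> sets Q" unfolding B_def by measurable
  moreover have "measure Q B \<le> \<delta>"
  proof -
    have "measure Q B \<le> exp (real t * (2 * a\<^sup>2 * G\<^sup>2 * r\<^sup>2) - a * (real t * e / 6))"
      unfolding B_def N_def W_def Q_def by (rule tail(2))
    also have "real t * (2 * a\<^sup>2 * G\<^sup>2 * r\<^sup>2) - a * (real t * e / 6) = - (real t / (288 * (G * r / e)\<^sup>2))"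
      using e G_pos r by (simp add: a_def field_simps power2_eq_square)
    also have "\<dots> \<le> - ln (1 / \<delta>)"
    proof -
      have "0 \<le> ln (1 / \<delta>) * (G * r / e)\<^sup>2" using \<delta> q by simp
      then have "ln (1 / \<delta>) * (288 * (G * r / e)\<^sup>2) \<le> real t" using tln by linarith
      then show ?thesis using q by (simp add: le_divide_eq)
    qed
    finally show "measure Q B \<le> \<delta>" using \<delta> by (simp add: ln_div)
  qed
  moreover have "F (psg_average (\<K> \<inter> cball (W\<^sub>0 y) r) g (\<lambda>\<tau>. y (\<iota> \<tau>)) \<eta> (W\<^sub>0 y) t) - F (U y) \<le> e / 2"
    if y: "y \<in> space Q - B" for y
  proof -
    have yQ: "y \<in> space Q" using y by simp
    note V = trust_region_nonempty_convex_closed[OF closed_feasible convex_feasible r W0(2)[OF yQ]]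
    have x: "y i \<in> space D" for i using yQ by (auto simp: Q_def space_PiM)
    have "F (psg_average (\<K> \<inter> cball (W\<^sub>0 y) r) g (\<lambda>\<tau>. y (\<iota> \<tau>)) \<eta> (W\<^sub>0 y) t) - F (U y)
      \<le> (norm (W\<^sub>0 y - U y))\<^sup>2 / (2 * \<eta> * real t) + \<eta> * G\<^sup>2 / 2 + (\<Sum>i<t. N i y) / real t"
      unfolding N_def W_def by (rule objective_psg_average_le[OF V(1,2) _ V(3) U(2)[OF yQ] x \<eta> t0]) auto
    moreover have "(norm (W\<^sub>0 y - U y))\<^sup>2 / (2 * \<eta> * real t) \<le> e / 6"
    proof -
      have "(norm (W\<^sub>0 y - U y))\<^sup>2 \<le> r\<^sup>2"
        using U(2)[OF yQ] by (intro power_mono) (auto simp: dist_norm)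
      moreover have "9 * (G\<^sup>2 * r\<^sup>2) \<le> real t * e\<^sup>2"
        using t9 e by (simp add: field_simps power_mult_distrib power_divide)
      ultimately have "9 * G\<^sup>2 * (norm (W\<^sub>0 y - U y))\<^sup>2 \<le> real t * e\<^sup>2"
        using mult_left_mono[of "(norm (W\<^sub>0 y - U y))\<^sup>2" "r\<^sup>2" "9 * G\<^sup>2"] by simp
      then show ?thesis
        using e t0 G_pos by (simp add: \<eta>_def field_simps power2_eq_square)
    qed
    moreover have "\<eta> * G\<^sup>2 / 2 = e / 6" using G_pos by (simp add: \<eta>_def)
    moreover have "(\<Sum>i<t. N i y) / real t \<le> e / 6"
      using y t0 by (simp add: B_def not_less field_simps)
    ultimately show ?thesis by linarith
  qed
  ultimately show ?thesis unfolding \<eta>_def by blast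
qed

end

section \<open>Stages and restarts\<close>

lemma power_powr_commute: "0 < x \<Longrightarrow> (x powr a) ^ n = (x ^ n) powr a"
  for x a :: real
  by (simp add: powr_powr mult.commute flip: powr_realpow)

lemma assg_c_cong:
  assumes "\<And>k. k \<in> {1..n} \<Longrightarrow> x k = x' k"
  shows "assg_c \<K> g G x w t D1 \<epsilon>0 n = assg_c \<K> g G x' w t D1 \<epsilon>0 n"
  using assms by (induction n) auto

lemma rassg_cong:
  assumes "\<And>s. s \<in> {1..n} \<Longrightarrow> x s = x' s"
  shows "rassg \<K> g G \<theta> \<omega> x w K D1 t1 \<epsilon>0 n = rassg \<K> g G \<theta> \<omega> x' w K D1 t1 \<epsilon>0 n"
  using assms by (induction n) auto

context bounded_stochastic_convex_problem
begin

lemma assg_c_feasible: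
  assumes "w \<in> \<K>" "0 < t" "0 < D1"
  shows "assg_c \<K> g G x w t D1 \<epsilon>0 n \<in> \<K>"
proof (induction n)
  case (Suc n)
  define v where "v = assg_c \<K> g G x w t D1 \<epsilon>0 n"
  note V = trust_region_nonempty_convex_closed[OF closed_feasible convex_feasible _ Suc.IH,
      of "D1 / 2 ^ n", folded v_def]
  have "psg_average (\<K> \<inter> cball v (D1 / 2 ^ n)) g (x (Suc n)) ((\<epsilon>0 / (3 * G\<^sup>2)) / 2 ^ n) v t
      \<in> \<K> \<inter> cball v (D1 / 2 ^ n)"
    by (rule psg_average_in[OF V(1,2,3)]) (use assms in auto)
  then show ?case by (simp add: v_def Let_def)
qed (use assms in simp)

lemma measurable_assg_c:
  assumes W0: "W\<^sub>0 \<in> borel_measurable M" "\<And>y. y \<in> space M \<Longrightarrow> W\<^sub>0 y \<in> \<K>"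
    and x: "\<And>k \<tau>. x k \<tau> \<in> measurable M D" and "0 < t" "0 < D1"
  shows "(\<lambda>y. assg_c \<K> g G (\<lambda>k \<tau>. x k \<tau> y) (W\<^sub>0 y) t D1 \<epsilon>0 n) \<in> borel_measurable M"
proof (induction n)
  case (Suc n)
  show ?case
    unfolding assg_c.simps Let_def
    by (rule measurable_psg_average[OF Suc.IH x]) (use assms assg_c_feasible in auto)
qed (use W0 in simp)

text \<open>Induction over the stages: the gap relative to the floor \<open>\<epsilon>\<close> halves in each stage, and so does the
  radius, so the ratio that determines the number of steps stays the same. The start is random,
  because in a restarted run it is the output of the previous call.\<close>

lemma assg_c_high_probability:
  fixes \<iota> :: "nat \<Rightarrow> nat \<Rightarrow> 'i" and W\<^sub>0 :: "('i \<Rightarrow> 'x) \<Rightarrow> 'a"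
  defines "Q \<equiv> \<Pi>\<^sub>M i\<in>(UNIV :: 'i set). D"
  assumes W0: "W\<^sub>0 \<in> borel_measurable Q" "\<And>y. y \<in> space Q \<Longrightarrow> W\<^sub>0 y \<in> \<K>"
    and \<iota>: "inj (\<lambda>(k, \<tau>). \<iota> k \<tau>)" and past: "\<And>y k \<tau> x. W\<^sub>0 (y(\<iota> k \<tau> := x)) = W\<^sub>0 y"
    and growth: "local_growth \<K> F \<epsilon>' c \<theta>" and \<epsilon>: "0 < \<epsilon>" "\<epsilon> \<le> \<epsilon>'" and "0 \<le> \<theta>" "0 \<le> c"
    and \<epsilon>0: "0 < \<epsilon>0" and D1: "0 < D1" "c * \<epsilon>0 / \<epsilon> powr (1 - \<theta>) \<le> D1" and \<delta>: "0 < \<delta>" "\<delta> < 1"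
    and t: "max 9 (1728 * ln (1 / \<delta>)) * (G * D1 / \<epsilon>0)\<^sup>2 \<le> real t"
  shows "\<exists>B \<in> sets Q. measure Q B \<le> real n * \<delta> \<and>
    (\<forall>y \<in> space Q - B. F (W\<^sub>0 y) - F_opt \<le> \<epsilon>0 + \<epsilon> \<longrightarrow>
      F (assg_c \<K> g G (\<lambda>k \<tau>. y (\<iota> k \<tau>)) (W\<^sub>0 y) t D1 \<epsilon>0 n) - F_opt \<le> \<epsilon>0 / 2 ^ n + \<epsilon>)"
proof (induction n)
  case 0
  show ?case by (intro bexI[of _ "{}"]) auto
next
  case (Suc n)
  interpret Q: prob_space Q unfolding Q_def by (rule prob_space_PiM) (rule prob_space_axioms)
  define A where "A = (\<lambda>n y. assg_c \<K> g G (\<lambda>k \<tau>. y (\<iota> k \<tau>)) (W\<^sub>0 y) t D1 \<epsilon>0 n)"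
  define r where "r = D1 / 2 ^ n"
  define e where "e = \<epsilon>0 / 2 ^ n"
  \<comment> \<open>On the event that an earlier stage failed, the reference point may lie outside the trust region.
    Projecting it keeps the noise bounded there, and changes nothing otherwise.\<close>
  define U where "U = (\<lambda>y. closest_point (\<K> \<inter> cball (A n y) r) (reference_point \<epsilon> (A n y)))"
  have r: "0 < r" and e: "0 < e" using D1 \<epsilon>0 by (auto simp: r_def e_def)
  have ratio: "G * r / e = G * D1 / \<epsilon>0" by (simp add: r_def e_def)
  have "0 < max 9 (1728 * ln (1 / \<delta>)) * (G * D1 / \<epsilon>0)\<^sup>2"
    using D1 \<epsilon>0 G_pos by (intro mult_pos_pos) auto
  then have t0: "0 < t" using t by (cases t) auto
  have A_in: "A n y \<in> \<K>" if "y \<in> space Q" for y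
    unfolding A_def using W0(2)[OF that] t0 D1 by (intro assg_c_feasible)
  have A_meas: "A n \<in> borel_measurable Q"
    unfolding A_def
    by (rule measurable_assg_c) (use W0 t0 D1 in \<open>auto simp: Q_def intro: measurable_component_singleton\<close>)
  have U_meas: "U \<in> borel_measurable Q"
    unfolding U_def using A_in borel_measurable_continuous_on_compose[OF continuous_on_reference_point A_meas] \<epsilon>
    by (intro borel_measurable_closest_point_trust_region closed_feasible convex_feasible r A_meas) auto
  have U_in: "U y \<in> \<K> \<inter> cball (A n y) r" if "y \<in> space Q" for y
  proof -
    note V = trust_region_nonempty_convex_closed[OF closed_feasible convex_feasible r A_in[OF that]]
    show ?thesis unfolding U_def by (rule closest_point_in_set[OF V(1,4)])
  qed
  have A_past: "A n (y(\<iota> (Suc n) \<tau> := x)) = A n y" for y \<tau> x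
    unfolding A_def past
  proof (rule assg_c_cong)
    fix k assume "k \<in> {1..n}"
    then have "\<iota> k \<tau>' \<noteq> \<iota> (Suc n) \<tau>" for \<tau>'
      using injD[OF \<iota>, of "(k, \<tau>')" "(Suc n, \<tau>)"] by auto
    then show "(\<lambda>\<tau>'. (y(\<iota> (Suc n) \<tau> := x)) (\<iota> k \<tau>')) = (\<lambda>\<tau>'. y (\<iota> k \<tau>'))" by auto
  qed
  have inj_Suc: "inj (\<iota> (Suc n))"
    using injD[OF \<iota>, of "(Suc n, _)" "(Suc n, _)"] by (auto intro!: injI)
  obtain B where B: "B \<in> sets Q" "measure Q B \<le> real n * \<delta>"
      "\<And>y. y \<in> space Q - B \<Longrightarrow> F (W\<^sub>0 y) - F_opt \<le> \<epsilon>0 + \<epsilon> \<Longrightarrow> F (A n y) - F_opt \<le> e + \<epsilon>"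
    using Suc.IH unfolding A_def e_def by blast
  have "\<exists>B \<in> sets Q. measure Q B \<le> \<delta> \<and> (\<forall>y \<in> space Q - B.
    F (psg_average (\<K> \<inter> cball (A n y) r) g (\<lambda>\<tau>. y (\<iota> (Suc n) \<tau>)) (e / (3 * G\<^sup>2)) (A n y) t) - F (U y) \<le> e / 2)"
    unfolding Q_def
  proof (rule stage_high_probability)
    show "U (y(\<iota> (Suc n) \<tau> := x)) = U y" for y \<tau> x by (simp only: U_def A_past)
    show "max 9 (1728 * ln (1 / \<delta>)) * (G * r / e)\<^sup>2 \<le> real t" unfolding ratio by (rule t)
  qed (use A_meas A_in U_meas U_in A_past inj_Suc r e \<delta> in \<open>simp_all add: Q_def\<close>)
  moreover have "A (Suc n) y = psg_average (\<K> \<inter> cball (A n y) r) g (\<lambda>\<tau>. y (\<iota> (Suc n) \<tau>)) (e / (3 * G\<^sup>2)) (A n y) t" for y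
    by (simp add: A_def Let_def r_def e_def mult.commute)
  ultimately obtain B' where B': "B' \<in> sets Q" "measure Q B' \<le> \<delta>"
      "\<And>y. y \<in> space Q - B' \<Longrightarrow> F (A (Suc n) y) - F (U y) \<le> e / 2"
    by auto
  have "F (A (Suc n) y) - F_opt \<le> e / 2 + \<epsilon>"
    if y: "y \<in> space Q - (B \<union> B')" and start: "F (W\<^sub>0 y) - F_opt \<le> \<epsilon>0 + \<epsilon>" for y
  proof -
    have yQ: "y \<in> space Q" using y by simp
    have "norm (A n y - reference_point \<epsilon> (A n y)) \<le> c * e / \<epsilon> powr (1 - \<theta>)"
      using B(3)[OF _ start] y e A_in[OF yQ] by (intro norm_diff_reference_point_le[OF growth \<epsilon> \<open>0 \<le> \<theta>\<close> \<open>0 \<le> c\<close>]) auto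
    also have "\<dots> \<le> r" using divide_right_mono[OF D1(2), of "2 ^ n"] by (simp add: r_def e_def mult.commute)
    finally have "reference_point \<epsilon> (A n y) \<in> \<K> \<inter> cball (A n y) r"
      using reference_point_feasible[OF \<epsilon>(1) A_in[OF yQ]] by (simp add: dist_norm)
    then have "U y = reference_point \<epsilon> (A n y)" unfolding U_def by (rule closest_point_self)
    then have "F (U y) \<le> F_opt + \<epsilon>" using objective_reference_point[OF \<epsilon>(1) A_in[OF yQ]] by simp
    then show ?thesis using B'(3)[of y] y by auto
  qed
  moreover have "measure Q (B \<union> B') \<le> real (Suc n) * \<delta>"
    using measure_Un_le[OF B(1) B'(1)] B(2) B'(2) by (simp add: algebra_simps)
  moreover have "e / 2 = \<epsilon>0 / 2 ^ Suc n" by (simp add: e_def)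
  ultimately show ?case
    using B(1) B'(1) unfolding A_def by (intro bexI[of _ "B \<union> B'"]) auto
qed

lemma rassg_feasible:
  assumes "w \<in> \<K>" "0 < D1" "0 < t1"
  shows "rassg \<K> g G \<theta> \<omega> x w K D1 t1 \<epsilon>0 n \<in> \<K>"
proof (induction n)
  case (Suc n)
  have "0 < rassg_t \<theta> t1 (Suc n)" using assms by (simp add: rassg_t_def)
  then show ?case using Suc assms by (auto intro!: assg_c_feasible mult_pos_pos)
qed (use assms in simp)

lemma measurable_rassg:
  assumes "w \<in> \<K>" "0 < D1" "0 < t1" and x: "\<And>s k \<tau>. x s k \<tau> \<in> measurable M D"
  shows "(\<lambda>y. rassg \<K> g G \<theta> \<omega> (\<lambda>s k \<tau>. x s k \<tau> y) w K D1 t1 \<epsilon>0 n) \<in> borel_measurable M"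
proof (induction n)
  case (Suc n)
  have "0 < rassg_t \<theta> t1 (Suc n)" using assms by (simp add: rassg_t_def)
  then show ?case
    unfolding rassg.simps
    by (intro measurable_assg_c[OF Suc] x) (use assms in \<open>auto intro!: rassg_feasible mult_pos_pos\<close>)
qed simp

text \<open>The floor of call \<open>s\<close> is \<open>\<epsilon>1 / 2 ^ (s - 1)\<close>, which is what the enlarged radius of that call
  permits. Every call starts anew from the initial gap \<open>\<epsilon>0\<close>, and the third assumption in \<open>\<epsilon>\<close> says that a
  successful call ends with a gap of at most \<open>\<epsilon>0\<close>.\<close>

lemma rassg_high_probability:
  fixes K :: nat
  defines "Q \<equiv> \<Pi>\<^sub>M i\<in>(UNIV :: (nat \<times> nat \<times> nat) set). D"
  assumes w0: "w\<^sub>0 \<in> \<K>" "F w\<^sub>0 - F_opt \<le> \<epsilon>0"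
    and growth: "local_growth \<K> F \<epsilon>1 c \<theta>" and \<theta>: "0 \<le> \<theta>" and c: "0 < c"
    and \<epsilon>: "0 < \<epsilon>0" "0 < \<epsilon>1" "\<epsilon>0 / 2 ^ K + \<epsilon>1 \<le> \<epsilon>0" and \<delta>: "0 < \<delta>" "\<delta> < 1"
  defines "D1 \<equiv> c * \<epsilon>0 / \<epsilon>1 powr (1 - \<theta>)"
  defines "t1 \<equiv> max 9 (1728 * ln (1 / \<delta>)) * (G * D1 / \<epsilon>0)\<^sup>2"
  shows "\<exists>B \<in> sets Q. measure Q B \<le> real n * real K * \<delta> \<and> (\<forall>y \<in> space Q - B.
    F (rassg \<K> g G \<theta> 1 (\<lambda>s k \<tau>. y (s, k, \<tau>)) w\<^sub>0 K D1 t1 \<epsilon>0 n) - F_opt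
      \<le> (if n = 0 then \<epsilon>0 else \<epsilon>0 / 2 ^ K + \<epsilon>1 / 2 ^ (n - 1)))"
proof (induction n)
  case 0
  show ?case using w0 by (intro bexI[of _ "{}"]) auto
next
  case (Suc n)
  interpret Q: prob_space Q unfolding Q_def by (rule prob_space_PiM) (rule prob_space_axioms)
  define R where "R = (\<lambda>n y. rassg \<K> g G \<theta> 1 (\<lambda>s k \<tau>. y (s, k, \<tau>)) w\<^sub>0 K D1 t1 \<epsilon>0 n)"
  define D' where "D' = D1 * (2 powr (1 - \<theta>)) ^ n"
  define t where "t = nat \<lceil>rassg_t \<theta> t1 (Suc n)\<rceil>"
  have D1: "0 < D1" using c \<epsilon> by (simp add: D1_def)
  have t1: "0 < t1" unfolding t1_def using D1 \<epsilon> G_pos by (intro mult_pos_pos) auto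
  have x: "(\<lambda>y. y (s, k, \<tau>)) \<in> measurable Q D" for s k \<tau>
    unfolding Q_def by (rule measurable_component_singleton) simp
  obtain B where B: "B \<in> sets Q" "measure Q B \<le> real n * real K * \<delta>"
      "\<And>y. y \<in> space Q - B \<Longrightarrow> F (R n y) - F_opt \<le> (if n = 0 then \<epsilon>0 else \<epsilon>0 / 2 ^ K + \<epsilon>1 / 2 ^ (n - 1))"
    using Suc.IH unfolding R_def by blast
  have start: "F (R n y) - F_opt \<le> \<epsilon>0" if "y \<in> space Q - B" for y
  proof -
    have "\<epsilon>1 / 2 ^ (n - 1) \<le> \<epsilon>1" using \<epsilon> by (simp add: divide_le_eq)
    then show ?thesis using B(3)[OF that] \<epsilon>(3) by (auto split: if_splits)
  qed
  have "\<exists>B \<in> sets Q. measure Q B \<le> real K * \<delta> \<and> (\<forall>y \<in> space Q - B.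
    F (R n y) - F_opt \<le> \<epsilon>0 + \<epsilon>1 / 2 ^ n \<longrightarrow>
      F (assg_c \<K> g G (\<lambda>k \<tau>. y (Suc n, k, \<tau>)) (R n y) t D' \<epsilon>0 K) - F_opt \<le> \<epsilon>0 / 2 ^ K + \<epsilon>1 / 2 ^ n)"
    unfolding Q_def
  proof (rule assg_c_high_probability[OF _ _ _ _ growth])
    show "R n \<in> borel_measurable (\<Pi>\<^sub>M i\<in>UNIV. D)"
      unfolding R_def by (rule measurable_rassg[OF w0(1) D1 t1 x[unfolded Q_def]])
    show "R n y \<in> \<K>" for y unfolding R_def by (rule rassg_feasible[OF w0(1) D1 t1])
    show "inj (\<lambda>(k, \<tau>). (Suc n, k, \<tau>))" by (auto intro: injI)
    show "R n (y((Suc n, k, \<tau>) := x)) = R n y" for y k \<tau> x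
      unfolding R_def by (rule rassg_cong) auto
    show "0 < D'" unfolding D'_def using D1 by simp
    show "c * \<epsilon>0 / (\<epsilon>1 / 2 ^ n) powr (1 - \<theta>) \<le> D'"
      unfolding D'_def D1_def using \<epsilon> by (simp add: powr_divide power_powr_commute)
    have "2 powr (2 * (1 - \<theta>)) = (2 powr (1 - \<theta>))\<^sup>2" by (simp add: power2_eq_square flip: powr_add)
    then have "(2 powr (2 * (1 - \<theta>))) ^ n = ((2 powr (1 - \<theta>)) ^ n)\<^sup>2" by (simp add: power_mult[symmetric] mult.commute)
    then have "rassg_t \<theta> t1 (Suc n) = max 9 (1728 * ln (1 / \<delta>)) * (G * D' / \<epsilon>0)\<^sup>2"
      by (simp add: rassg_t_def t1_def D'_def power_mult_distrib power_divide)
    then show "max 9 (1728 * ln (1 / \<delta>)) * (G * D' / \<epsilon>0)\<^sup>2 \<le> real t"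
      unfolding t_def by linarith
    show "\<epsilon>1 / 2 ^ n \<le> \<epsilon>1" using \<epsilon> by (simp add: divide_le_eq)
  qed (use \<epsilon> \<theta> c \<delta> in auto)
  moreover have "R (Suc n) y = assg_c \<K> g G (\<lambda>k \<tau>. y (Suc n, k, \<tau>)) (R n y) t D' \<epsilon>0 K" for y
    by (simp add: R_def t_def D'_def)
  ultimately obtain B' where B': "B' \<in> sets Q" "measure Q B' \<le> real K * \<delta>"
      "\<And>y. y \<in> space Q - B' \<Longrightarrow> F (R n y) - F_opt \<le> \<epsilon>0 + \<epsilon>1 / 2 ^ n \<Longrightarrow>
        F (R (Suc n) y) - F_opt \<le> \<epsilon>0 / 2 ^ K + \<epsilon>1 / 2 ^ n"
    by auto
  have "F (R (Suc n) y) - F_opt \<le> \<epsilon>0 / 2 ^ K + \<epsilon>1 / 2 ^ n" if "y \<in> space Q - (B \<union> B')" for y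
  proof (rule B'(3))
    have "0 \<le> \<epsilon>1 / 2 ^ n" using \<epsilon> by simp
    then show "F (R n y) - F_opt \<le> \<epsilon>0 + \<epsilon>1 / 2 ^ n" using start[of y] that by simp
  qed (use that in auto)
  moreover have "measure Q (B \<union> B') \<le> real (Suc n) * real K * \<delta>"
    using measure_Un_le[OF B(1) B'(1)] B(2) B'(2) by (simp add: algebra_simps)
  ultimately show ?case
    using B(1) B'(1) unfolding R_def by (intro bexI[of _ "B \<union> B'"]) auto
qed

end

text \<open>Transfers statements from the product space to the space on which the samples are given.\<close>

lemma distr_iid_samples:
  assumes "iid_samples P D X"
  shows "(\<lambda>z (s, k, \<tau>). X s k \<tau> z) \<in> measurable P (\<Pi>\<^sub>M i\<in>(UNIV :: (nat \<times> nat \<times> nat) set). D)"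
    and "distr P (\<Pi>\<^sub>M i\<in>(UNIV :: (nat \<times> nat \<times> nat) set). D) (\<lambda>z (s, k, \<tau>). X s k \<tau> z)
      = (\<Pi>\<^sub>M i\<in>(UNIV :: (nat \<times> nat \<times> nat) set). D)"
proof -
  interpret prob_space P using assms by (simp add: iid_samples_def)
  let ?X = "\<lambda>(s, k, \<tau>). X s k \<tau>"
  have indep: "indep_vars (\<lambda>_. D) ?X UNIV" and law: "distr P D (?X i) = D" for i
    using assms by (auto simp: iid_samples_def split: prod.splits)
  have rv: "?X i \<in> measurable P D" for i using indep unfolding indep_vars_def by blast
  have eq: "(\<lambda>z (s, k, \<tau>). X s k \<tau> z) = (\<lambda>z. \<lambda>i\<in>UNIV. ?X i z)" by (auto simp: fun_eq_iff)
  show "(\<lambda>z (s, k, \<tau>). X s k \<tau> z) \<in> measurable P (\<Pi>\<^sub>M i\<in>(UNIV :: (nat \<times> nat \<times> nat) set). D)"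
    unfolding eq by (rule measurable_restrict) (rule rv)
  show "distr P (\<Pi>\<^sub>M i\<in>(UNIV :: (nat \<times> nat \<times> nat) set). D) (\<lambda>z (s, k, \<tau>). X s k \<tau> z)
      = (\<Pi>\<^sub>M i\<in>(UNIV :: (nat \<times> nat \<times> nat) set). D)"
    unfolding eq using indep_vars_iff_distr_eq_PiM[OF _ rv, THEN iffD1, OF _ indep] by (simp add: law)
qed

section \<open>Counting iterations\<close>

text \<open>The geometric sum is at most \<open>q ^ S / (q - 1)\<close>. Rounding up and the extra call add less than \<open>2\<close> to
  the exponent \<open>log 2 (\<epsilon>1 / \<epsilon>)\<close>, which accounts for \<open>q\<^sup>2\<close>.\<close>

lemma sum_rassg_t_le:
  fixes \<theta> \<epsilon> \<epsilon>1 t1 :: real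
  assumes \<theta>: "\<theta> < 1" and \<epsilon>: "0 < \<epsilon>" "\<epsilon> \<le> \<epsilon>1" and t1: "0 \<le> t1"
  defines "q \<equiv> 2 powr (2 * (1 - \<theta>))"
  shows "(\<Sum>s=1..nat \<lceil>log 2 (\<epsilon>1 / \<epsilon>)\<rceil> + 1. rassg_t \<theta> t1 s)
    \<le> t1 * (q\<^sup>2 / (q - 1)) * (\<epsilon>1 / \<epsilon>) powr (2 * (1 - \<theta>))"
proof -
  define l where "l = log 2 (\<epsilon>1 / \<epsilon>)"
  define S where "S = nat \<lceil>l\<rceil> + 1"
  have "1 powr (2 * (1 - \<theta>)) < q" unfolding q_def using \<theta> by (intro powr_less_mono2) auto
  then have q: "1 < q" by simp
  have l: "0 \<le> l" "2 powr l = \<epsilon>1 / \<epsilon>" using \<epsilon> by (auto simp: l_def)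
  have S: "real S \<le> l + 2" unfolding S_def using l(1) by linarith
  have "(\<Sum>s=1..S. rassg_t \<theta> t1 s) = (\<Sum>i<S. t1 * q ^ i)"
    by (rule sum.reindex_bij_witness[of _ Suc "\<lambda>i. i - 1"]) (auto simp: rassg_t_def q_def)
  also have "\<dots> = t1 * ((q ^ S - 1) / (q - 1))" using q by (simp add: geometric_sum sum_distrib_left[symmetric])
  also have "\<dots> \<le> t1 * (q\<^sup>2 * (\<epsilon>1 / \<epsilon>) powr (2 * (1 - \<theta>)) / (q - 1))"
  proof (intro mult_left_mono divide_right_mono t1)
    have "q ^ S = q powr real S" using q by (simp add: powr_realpow)
    also have "\<dots> \<le> q powr (l + 2)" using q S by (intro powr_mono) auto
    also have "\<dots> = q\<^sup>2 * q powr l" using q by (simp add: powr_add)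
    also have "q powr l = (\<epsilon>1 / \<epsilon>) powr (2 * (1 - \<theta>))"
      unfolding l(2)[symmetric] q_def powr_powr by (simp add: mult.commute)
    finally show "q ^ S - 1 \<le> q\<^sup>2 * (\<epsilon>1 / \<epsilon>) powr (2 * (1 - \<theta>))" by simp
  qed (use q in simp)
  finally show ?thesis by (simp add: S_def l_def algebra_simps)
qed

text \<open>Rounding \<open>rassg_t \<theta> t1 s\<close> up adds less than one, and averaging \<open>t\<close> iterates takes \<open>t - 1\<close> steps, so
  rounding does not increase the count.\<close>

lemma rassg_iterations_le:
  assumes "0 \<le> t1"
  shows "real (rassg_iterations \<theta> K t1 S) \<le> (\<Sum>s=1..S. real K * rassg_t \<theta> t1 s)"
proof -
  have "real (nat \<lceil>rassg_t \<theta> t1 s\<rceil> - 1) \<le> rassg_t \<theta> t1 s" for s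
  proof -
    have "0 \<le> rassg_t \<theta> t1 s" using assms by (simp add: rassg_t_def)
    then show ?thesis by linarith
  qed
  then show ?thesis
    unfolding rassg_iterations_def of_nat_sum of_nat_mult by (intro sum_mono mult_left_mono) auto
qed

section \<open>Convergence of the restarted method\<close>

theorem theorem10:
  fixes \<theta> G :: real
  assumes "0 < \<theta>" "\<theta> < 1" "0 < G"
  shows "\<exists>C>0. \<forall>(D :: 'x measure) (\<K> :: (real ^ 'n) set) f g
      (P :: 'o measure) X w0 \<epsilon>0 \<epsilon> \<epsilon>1 c \<delta> \<delta>' K S D1 t1 T.
    stochastic_convex_problem D \<K> f g \<and> iid_samples P D X \<and>
    w0 \<in> \<K> \<and> objective D f w0 - optimal_value \<K> (objective D f) \<le> \<epsilon>0 \<and>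
    (\<forall>w\<in>\<K>. \<forall>x\<in>space D. norm (g w x) \<le> G) \<and>
    0 < \<epsilon> \<and> \<epsilon> \<le> \<epsilon>0 / 4 \<and> K = nat \<lceil>log 2 (\<epsilon>0 / \<epsilon>)\<rceil> \<and>
    \<epsilon> \<le> \<epsilon>1 \<and> \<epsilon>1 \<le> \<epsilon>0 / 2 \<and>
    0 < c \<and> local_growth \<K> (objective D f) \<epsilon>1 c \<theta> \<and>
    D1 = c * \<epsilon>0 / \<epsilon>1 powr (1 - \<theta>) \<and>
    0 < \<delta> \<and> \<delta> < 1 \<and> \<delta>' = \<delta> / (real K * (real K + 1)) \<and>
    t1 = max 9 (1728 * ln (1 / \<delta>')) * (G * D1 / \<epsilon>0)\<^sup>2 \<and>
    S = nat \<lceil>log 2 (\<epsilon>1 / \<epsilon>)\<rceil> + 1 \<and>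
    T = (\<Sum>s=1..S. real K * rassg_t \<theta> t1 s)
    \<longrightarrow>
    measure P {z \<in> space P.
        objective D f (rassg \<K> g G \<theta> 1 (\<lambda>s k \<tau>. X s k \<tau> z) w0 K D1 t1 \<epsilon>0 S)
          - optimal_value \<K> (objective D f) \<le> 2 * \<epsilon>} \<ge> 1 - \<delta> \<and>
    real (rassg_iterations \<theta> K t1 S) \<le> T \<and>
    T \<le> C * (real K * ln (1 / \<delta>') * c\<^sup>2 / \<epsilon> powr (2 * (1 - \<theta>))) \<and>
    (\<forall>p\<ge>0. real K * (real K + 1) \<le> (1 / \<delta>) powr p \<longrightarrow>
        T \<le> C * (1 + p) * (real K * ln (1 / \<delta>) * c\<^sup>2 / \<epsilon> powr (2 * (1 - \<theta>))))"
proof -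
  define q :: real where "q = 2 powr (2 * (1 - \<theta>))"
  have "1 powr (2 * (1 - \<theta>)) < q" unfolding q_def using assms by (intro powr_less_mono2) auto
  then have q: "1 < q" by simp
  define C where "C = 1728 * G\<^sup>2 * (q\<^sup>2 / (q - 1))"
  have C: "0 < C" using assms q by (auto simp: C_def)
  show ?thesis
  proof (intro exI[of _ C] conjI[OF C] allI impI, elim conjE)
    fix D :: "'x measure" and \<K> :: "(real ^ 'n) set" and f g
      and P :: "'o measure" and X w0 \<epsilon>0 \<epsilon> \<epsilon>1 c \<delta> \<delta>' K S D1 t1 T
    assume problem: "stochastic_convex_problem D \<K> f g" and iid: "iid_samples P D X"
      and w0: "w0 \<in> \<K>" "objective D f w0 - optimal_value \<K> (objective D f) \<le> \<epsilon>0"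
      and bound: "\<forall>w\<in>\<K>. \<forall>x\<in>space D. norm (g w x) \<le> G"
      and \<epsilon>: "0 < \<epsilon>" "\<epsilon> \<le> \<epsilon>0 / 4" and K: "K = nat \<lceil>log 2 (\<epsilon>0 / \<epsilon>)\<rceil>"
      and \<epsilon>1: "\<epsilon> \<le> \<epsilon>1" "\<epsilon>1 \<le> \<epsilon>0 / 2"
      and c: "0 < c" and growth: "local_growth \<K> (objective D f) \<epsilon>1 c \<theta>"
      and D1: "D1 = c * \<epsilon>0 / \<epsilon>1 powr (1 - \<theta>)"
      and \<delta>: "0 < \<delta>" "\<delta> < 1" and \<delta>': "\<delta>' = \<delta> / (real K * (real K + 1))"
      and t1: "t1 = max 9 (1728 * ln (1 / \<delta>')) * (G * D1 / \<epsilon>0)\<^sup>2"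
      and S: "S = nat \<lceil>log 2 (\<epsilon>1 / \<epsilon>)\<rceil> + 1"
      and T: "T = (\<Sum>s=1..S. real K * rassg_t \<theta> t1 s)"
    interpret bounded_stochastic_convex_problem D \<K> f g G
      using problem bound assms
      by (auto simp: bounded_stochastic_convex_problem_def bounded_stochastic_convex_problem_axioms_def)
    define Q where "Q = (\<Pi>\<^sub>M i\<in>(UNIV :: (nat \<times> nat \<times> nat) set). D)"
    interpret Q: prob_space Q unfolding Q_def by (rule prob_space_PiM) (rule prob_space_axioms)
    have pos: "0 < \<epsilon>0" "0 < \<epsilon>1" using \<epsilon> \<epsilon>1 by auto

    \<comment> \<open>After \<open>K\<close> stages the initial gap, halved in each, and after \<open>S\<close> calls the floor is at most
      \<open>\<epsilon>\<close>. The union bound needs \<open>S \<le> K\<close>.\<close>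
    have "log 2 4 \<le> log 2 (\<epsilon>0 / \<epsilon>)" using \<epsilon> pos by (subst log_le_cancel_iff) (auto simp: field_simps)
    moreover have "log 2 4 = (2 :: real)" using log_pow_cancel[of 2 2] by simp
    ultimately have log2: "2 \<le> log 2 (\<epsilon>0 / \<epsilon>)" by simp
    then have K2: "2 \<le> K" unfolding K by linarith
    have "log 2 (\<epsilon>0 / \<epsilon>) \<le> real K" unfolding K by linarith
    then have "\<epsilon>0 / \<epsilon> \<le> 2 powr real K" using \<epsilon> pos by (simp add: log_le_iff)
    then have K_final: "\<epsilon>0 / 2 ^ K \<le> \<epsilon>" using \<epsilon> by (simp add: powr_realpow field_simps)
    have "log 2 (\<epsilon>1 / \<epsilon>) \<le> log 2 (\<epsilon>0 / \<epsilon> / 2)"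
      using \<epsilon> \<epsilon>1 pos by (subst log_le_cancel_iff) (auto simp: field_simps)
    also have "\<dots> = log 2 (\<epsilon>0 / \<epsilon>) - 1" using \<epsilon> pos by (subst log_divide) auto
    finally have "S \<le> K" unfolding S K using log2 by linarith
    have "log 2 (\<epsilon>1 / \<epsilon>) \<le> real (S - 1)" unfolding S by linarith
    then have "\<epsilon>1 / \<epsilon> \<le> 2 powr real (S - 1)" using \<epsilon> pos by (simp add: log_le_iff)
    then have S_final: "\<epsilon>1 / 2 ^ (S - 1) \<le> \<epsilon>" using \<epsilon> by (simp add: powr_realpow field_simps)

    \<comment> \<open>Since \<open>K \<ge> 2\<close>, the logarithm of \<open>1 / \<delta>'\<close> is at least \<open>1\<close>, so it absorbs the constant \<open>9\<close> of \<open>t1\<close>.\<close>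
    have KK: "6 \<le> real K * (real K + 1)"
      using mult_mono[of 2 "real K" 3 "real K + 1"] K2 by simp
    have d': "0 < \<delta>'" "\<delta>' < 1" using \<delta> KK K2 by (auto simp: \<delta>' divide_simps)
    have ln_d': "ln (1 / \<delta>') = ln (1 / \<delta>) + ln (real K * (real K + 1))"
      using \<delta> KK K2 by (simp add: \<delta>' ln_div)
    have "exp 1 \<le> real K * (real K + 1)" using exp_le KK by simp
    then have "1 \<le> ln (real K * (real K + 1))" using KK by (subst ln_ge_iff) auto
    moreover have "0 \<le> ln (1 / \<delta>)" using \<delta> by (intro ln_ge_zero) simp
    ultimately have L1: "1 \<le> ln (1 / \<delta>')" unfolding ln_d' by linarith
    have t1_pos: "0 < t1" unfolding t1 D1 using c pos G_pos by (intro mult_pos_pos) auto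

    have "1 - \<delta> \<le> measure P {z \<in> space P. F (rassg \<K> g G \<theta> 1 (\<lambda>s k \<tau>. X s k \<tau> z) w0 K D1 t1 \<epsilon>0 S) - F_opt \<le> 2 * \<epsilon>}"
    proof -
      define R where "R = (\<lambda>y. rassg \<K> g G \<theta> 1 (\<lambda>s k \<tau>. y (s, k, \<tau>)) w0 K D1 t1 \<epsilon>0 S)"
      define Y where "Y = (\<lambda>z (s, k, \<tau>). X s k \<tau> z)"
      have Y: "Y \<in> measurable P Q" "distr P Q Y = Q"
        using distr_iid_samples[OF iid] by (simp_all add: Y_def Q_def)
      have D1_pos: "0 < D1" unfolding D1 using c pos by simp
      have [measurable]: "(\<lambda>y. F (R y)) \<in> borel_measurable Q"
        unfolding R_def
        by (rule borel_measurable_continuous_on_compose[OF continuous_on_objective measurable_rassg])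
          (auto simp: Q_def intro: rassg_feasible w0 D1_pos t1_pos measurable_component_singleton)
      obtain B where B: "B \<in> sets Q" "measure Q B \<le> real S * real K * \<delta>'"
        "\<And>y. y \<in> space Q - B \<Longrightarrow> F (R y) - F_opt \<le> (if S = 0 then \<epsilon>0 else \<epsilon>0 / 2 ^ K + \<epsilon>1 / 2 ^ (S - 1))"
        using rassg_high_probability[OF w0 growth _ c pos _ d', of K S] assms \<epsilon> \<epsilon>1 K_final
        unfolding R_def t1 D1 Q_def by auto
      have "real S * real K * \<delta>' \<le> real K * real K * \<delta>'"
        using \<open>S \<le> K\<close> d' by (intro mult_right_mono) auto
      also have "\<dots> \<le> (real K * (real K + 1)) * \<delta>'"
        using d' by (intro mult_right_mono) (auto simp: algebra_simps)
      also have "\<dots> = \<delta>" using K2 by (simp add: \<delta>')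
      finally have "1 - \<delta> \<le> 1 - measure Q B" using B(2) by simp
      also have "\<dots> = measure Q (space Q - B)" using B(1) by (simp add: Q.prob_compl)
      also have "\<dots> \<le> measure Q {y \<in> space Q. F (R y) - F_opt \<le> 2 * \<epsilon>}"
      proof (rule Q.finite_measure_mono)
        show "space Q - B \<subseteq> {y \<in> space Q. F (R y) - F_opt \<le> 2 * \<epsilon>}"
          using B(3) K_final S_final S by force
      qed measurable
      also have "\<dots> = measure (distr P Q Y) {y \<in> space Q. F (R y) - F_opt \<le> 2 * \<epsilon>}" by (simp only: Y(2))
      also have "\<dots> = measure P (Y -` {y \<in> space Q. F (R y) - F_opt \<le> 2 * \<epsilon>} \<inter> space P)"
        by (rule measure_distr[OF Y(1)]) measurable
      also have "Y -` {y \<in> space Q. F (R y) - F_opt \<le> 2 * \<epsilon>} \<inter> space P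
          = {z \<in> space P. F (rassg \<K> g G \<theta> 1 (\<lambda>s k \<tau>. X s k \<tau> z) w0 K D1 t1 \<epsilon>0 S) - F_opt \<le> 2 * \<epsilon>}"
        using measurable_space[OF Y(1)] by (auto simp: R_def Y_def)
      finally show ?thesis .
    qed
    moreover have "real (rassg_iterations \<theta> K t1 S) \<le> T"
      unfolding T using t1_pos by (intro rassg_iterations_le) simp
    moreover have T_le: "T \<le> C * (real K * ln (1 / \<delta>') * c\<^sup>2 / \<epsilon> powr (2 * (1 - \<theta>)))"
    proof -
      have split: "\<epsilon>1 powr (2 * (1 - \<theta>)) = (\<epsilon>1 powr (1 - \<theta>))\<^sup>2"
        by (simp add: power2_eq_square flip: powr_add)
      have GD: "(G * D1 / \<epsilon>0)\<^sup>2 = G\<^sup>2 * c\<^sup>2 / \<epsilon>1 powr (2 * (1 - \<theta>))"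
        unfolding D1 split using pos by (simp add: power_mult_distrib power_divide)
      have "max 9 (1728 * ln (1 / \<delta>')) = 1728 * ln (1 / \<delta>')" using L1 by (simp add: max_def)
      then have t1': "t1 = 1728 * ln (1 / \<delta>') * (G\<^sup>2 * c\<^sup>2 / \<epsilon>1 powr (2 * (1 - \<theta>)))" by (simp add: t1 GD)
      have "T = real K * (\<Sum>s=1..nat \<lceil>log 2 (\<epsilon>1 / \<epsilon>)\<rceil> + 1. rassg_t \<theta> t1 s)"
        unfolding T S by (rule sum_distrib_left[symmetric])
      also have "\<dots> \<le> real K * (t1 * (q\<^sup>2 / (q - 1)) * (\<epsilon>1 / \<epsilon>) powr (2 * (1 - \<theta>)))"
        unfolding q_def using assms \<epsilon> \<epsilon>1 t1_pos by (intro mult_left_mono sum_rassg_t_le) auto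
      also have "\<dots> = C * (real K * ln (1 / \<delta>') * c\<^sup>2 / \<epsilon> powr (2 * (1 - \<theta>)))"
        unfolding t1' C_def using pos \<epsilon> by (simp add: powr_divide)
      finally show ?thesis .
    qed
    moreover have "T \<le> C * (1 + p) * (real K * ln (1 / \<delta>) * c\<^sup>2 / \<epsilon> powr (2 * (1 - \<theta>)))"
      if p: "0 \<le> p" "real K * (real K + 1) \<le> (1 / \<delta>) powr p" for p
    proof -
      have "ln (real K * (real K + 1)) \<le> ln ((1 / \<delta>) powr p)"
        using p KK by (subst ln_le_cancel_iff) (use \<delta> in auto)
      then have L: "ln (1 / \<delta>') \<le> (1 + p) * ln (1 / \<delta>)"
        using \<delta> by (simp add: ln_d' ln_powr algebra_simps)
      have "C * (real K * ln (1 / \<delta>') * c\<^sup>2 / \<epsilon> powr (2 * (1 - \<theta>)))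
          = ln (1 / \<delta>') * (C * (real K * c\<^sup>2 / \<epsilon> powr (2 * (1 - \<theta>))))" by simp
      also have "\<dots> \<le> (1 + p) * ln (1 / \<delta>) * (C * (real K * c\<^sup>2 / \<epsilon> powr (2 * (1 - \<theta>))))"
        using C by (intro mult_right_mono L) auto
      finally show ?thesis using T_le by (simp add: algebra_simps)
    qed
    ultimately show "1 - \<delta> \<le> measure P {z \<in> space P.
        objective D f (rassg \<K> g G \<theta> 1 (\<lambda>s k \<tau>. X s k \<tau> z) w0 K D1 t1 \<epsilon>0 S)
          - optimal_value \<K> (objective D f) \<le> 2 * \<epsilon>} \<and>
      real (rassg_iterations \<theta> K t1 S) \<le> T \<and>
      T \<le> C * (real K * ln (1 / \<delta>') * c\<^sup>2 / \<epsilon> powr (2 * (1 - \<theta>))) \<and>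
      (\<forall>p\<ge>0. real K * (real K + 1) \<le> (1 / \<delta>) powr p \<longrightarrow>
        T \<le> C * (1 + p) * (real K * ln (1 / \<delta>) * c\<^sup>2 / \<epsilon> powr (2 * (1 - \<theta>))))"
      by blast
  qed
qed

end
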